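(* Consider the combined distribution–modal split–assignment problem with primal objective $P_3(f,d)$ and dual objective $D_3'(t)$, and the Universal Method of Similar Triangles (USTM) with accuracy parameter $\varepsilon>0$ applied to minimize $-D_3'(t)=\varphi_3(t)+h(t)$ (with $\Phi=\varphi_3$), all as defined in the context. Assume $t^0=\bar t$, $L_0\le \frac{M^2}{\varepsilon}$, where $M=\sqrt{2H_{\max}}\,N$, and that at the $k$-th iteration the problem $\min_{d\in\Pi(l,w)}E(d,T(t))$ is solved with accuracy $\delta_k=\frac{s_{k+1}\varepsilon}{4A_{k+1}}$ (for each $t$ at which the inexact oracle is called). Let $t^*$ be a maximizer of $D_3'$ over $t\ge\bar t$ and define $$R=\|t^*-\bar t\|_2,\qquad \tilde R^2=\rho^2N^{2/\mu}\sum_{e\in\mathcal E}\frac{\bar t_e^2}{\bar f_e^{2/\mu}}.$$ (1) In the case of the Beckmann model, after at most $K=4\left(\frac{M\tilde R}{\varepsilon}\right)^2$ iterations (rounded up to an integer) it holds that $$0\le P_3(\hat f^K,\hat d^K)-D_3'(t^K)\le\varepsilon .$$ (2) In the case of the Stable Dynamics model, with $R>0$, after at most $K=4\left(\frac{MR}{\varepsilon}\right)^2$ iterations (rounded up to an integer) it holds that $$0\le P_3(\hat f^K,\hat d^K)-D_3'(t^K)+\langle(\hat f^K-\bar f)_+,\,t^*-\bar t\rangle\le\varepsilon,\qquad \|(\hat f^K-\bar f)_+\|_2\le\frac{2\varepsilon}{R}.$$ Here $(\cdot)_+$ is the componentwise positive part, applied to the vector of total link flows.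
   Context: **Network.** $\mathcal G=(\mathcal V,\mathcal E)$ is a finite directed (multi-modal) graph. Indices: $i\in O$ origins, $j\in D$ destinations, $r$ trip purposes, $a$ agent types, $m$ travel modes (all finite sets). $P_{ij}^m$ is the (nonempty) set of simple paths from $i$ to $j$ available to mode $m$; $H_{\max}\le|\mathcal V|-1$ is the maximum number of links of a simple path in the network. Each link $e$ has free-flow time $\bar t_e>0$, capacity $\bar f_e>0$ and constant mode-specific costs $c_e^m\ge0$. Parameters: $\alpha_a>0$, $\beta_{am}\in\mathbb R$, $\gamma_r>0$, $\rho>0$, $\mu>0$. **Demand.** Given $l_i^{ra}\ge0$, $w_j^r\ge0$ with $\sum_{i,a}l_i^{ra}=\sum_jw_j^r=:N_r$ for each $r$, and $N=\sum_rN_r>0$. Set $\Pi'(l,w)=\{d=(d_{ij}^{ram})\ge0:\sum_{j,m}d_{ij}^{ram}=l_i^{ra},\ \sum_{i,a,m}d_{ij}^{ram}=w_j^r\}$ and $\Pi(l,w)=\{d=(d_{ij}^{ra})\ge0:\sum_jd_{ij}^{ra}=l_i^{ra},\ \sum_{i,a}d_{ij}^{ra}=w_j^r\}$. For $d\in\Pi'(l,w)$ write $d_{ij}^{ra}=\sum_md_{ij}^{ram}$. (Convention $0\ln0=0$.) **Flows.** For $d\in\Pi'(l,w)$, path flows are $x_p^{ram}\ge0$ with $\sum_{p\in P_{ij}^m}x_p^{ram}=d_{ij}^{ram}$; they induce link flows $f_e^m=\sum_{r,a}\sum_{i,j}\sum_{p\in P_{ij}^m,\,p\ni e}x_p^{ram}$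 and total link flows $f_e=\sum_mf_e^m$. **Primal problem.** $P_3(f,d)=\Psi(f)+H(d)$ is minimized over $d\in\Pi'(l,w)$ and link flows $f$ induced by path flows for $d$ (in the Stable Dynamics case also subject to $f_e\le\bar f_e$), where $$\Psi(f)=\sum_{e\in\mathcal E}\Big(\sigma_e(f_e)+\sum_mc_e^mf_e^m\Big),$$ $$H(d)=\sum_{i,j,r,a}\frac1{\gamma_r}d_{ij}^{ra}\ln d_{ij}^{ra}+\sum_{i,j,r,a,m}\frac1{\alpha_a}d_{ij}^{ram}\Big(\ln\frac{d_{ij}^{ram}}{d_{ij}^{ra}}+\beta_{am}\Big).$$ - *Beckmann model:* $\sigma_e(f_e)=\int_0^{f_e}\tau_e(z)\,dz$ with $\tau_e(z)=\bar t_e\big(1+\rho(z/\bar f_e)^{1/\mu}\big)$, and $h(t)=\sum_e\sigma_e^*(t_e)$ for $t\ge\bar t$, where $\sigma_e^*(t_e)=\sup_{f_e\ge0}\{t_ef_e-\sigma_e(f_e)\}=\bar f_e\left(\frac{t_e-\bar t_e}{\bar t_e\rho}\right)^{\mu}\frac{t_e-\bar t_e}{1+\mu}$. - *Stable Dynamics model:* $\sigma_e(f_e)=\bar t_ef_e$ (capacity constraints $f_e\le\bar f_e$ are imposed separately, and $P_3$ is evaluated by this formula also when they are violated), and $h(t)=\langle t-\bar t,\bar f\rangle$ for $t\ge\bar t$. In both cases $\operatorname{dom}h=\{t\in\mathbb R^{\mathcal E}:t\ge\bar t\}$. **Dual problem.** For $t\ge0$, $T_{ij}^m(t)=\min_{p\in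 P_{ij}^m}\sum_{e\in p}(t_e+c_e^m)$, $T_{ij}^a(t)=-\frac1{\alpha_a}\ln\sum_m\exp(-\alpha_aT_{ij}^m(t)-\beta_{am})$, and for $d\in\Pi(l,w)$ $$E(d,T(t))=\sum_{i,j,r,a}d_{ij}^{ra}T_{ij}^a(t)+\sum_{i,j,r,a}\frac1{\gamma_r}d_{ij}^{ra}\ln d_{ij}^{ra}.$$ Put $\varphi_3(t)=-\min_{d\in\Pi(l,w)}E(d,T(t))$ and $D_3'(t)=-\varphi_3(t)-h(t)$, maximized over $t\ge\bar t$. **Inexact oracle.** For accuracy $\delta\ge0$, let $\tilde d(t)\in\Pi(l,w)$ satisfy $E(\tilde d(t),T(t))\le\min_{d\in\Pi(l,w)}E(d,T(t))+\delta$. Define $d'(t)\in\Pi'(l,w)$ by $d_{ij}'^{\,ram}(t)=\tilde d_{ij}^{ra}(t)\,\frac{\exp(-\alpha_aT_{ij}^m(t)-\beta_{am})}{\sum_{m'}\exp(-\alpha_aT_{ij}^{m'}(t)-\beta_{am'})}$. The oracle returns $\tilde\Phi(t)=\tilde\varphi_3(t)=-E(\tilde d(t),T(t))$ and $\tilde\nabla\Phi(t)=\tilde\nabla\varphi_3(t)=-\nabla_tE(\tilde d(t),T(t))$, where $\nabla_tE(\tilde d(t),T(t))$ is a supergradient in $t$ (with $\tilde d(t)$ held fixed), i.e. the vector of total link flows obtained by sending each $d_{ij}'^{\,ram}(t)$ along shortest paths of $P_{ij}^m$ for link costs $t_e+c_e^m$ (arbitrarily split among shortest paths). **USTM.** Input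 $L_0>0$, $t^0$, $\varepsilon>0$. Set $u^0=t^0$, $A_0=0$, $\phi_0(t)=\frac12\|t-t^0\|_2^2$. Iteration $k=0,1,2,\dots$: set $L_{k+1}=L_k/2$ and repeat: compute $s_{k+1}=\frac1{2L_{k+1}}+\sqrt{\frac1{4L_{k+1}^2}+\frac{A_k}{L_{k+1}}}$, $A_{k+1}=A_k+s_{k+1}$, $y^{k+1}=\frac{s_{k+1}u^k+A_kt^k}{A_{k+1}}$, $\phi_{k+1}(t)=\phi_k(t)+s_{k+1}\big[\tilde\Phi(y^{k+1})+\langle\tilde\nabla\Phi(y^{k+1}),t-y^{k+1}\rangle+h(t)\big]$, $u^{k+1}=\arg\min_{t\in\operatorname{dom}h}\phi_{k+1}(t)$, $t^{k+1}=\frac{s_{k+1}u^{k+1}+A_kt^k}{A_{k+1}}$; if $$\tilde\Phi(t^{k+1})\le\tilde\Phi(y^{k+1})+\langle\tilde\nabla\Phi(y^{k+1}),t^{k+1}-y^{k+1}\rangle+\tfrac{L_{k+1}}2\|t^{k+1}-y^{k+1}\|_2^2+\tfrac{s_{k+1}}{2A_{k+1}}\varepsilon,$$ accept these values and go to the next iteration; otherwise replace $L_{k+1}$ by $2L_{k+1}$ and repeat. **Primal reconstruction.** Let $[f^k]_e^m$ be the mode-$m$ link flows by shortest paths for times $y^k$ and trip matrix $d'(y^k)$, chosen so that $\sum_m[f^k]_e^m=-[\tilde\nabla\varphi_3(y^k)]_e$. After $K$ iterations, $$\hat d^K=\frac1{A_K}\sum_{k=1}^Ks_k\,d'(y^k)\in\Pi'(l,w),\qquad[\hat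 f^K]_e^m=\frac1{A_K}\sum_{k=1}^Ks_k[f^k]_e^m,\qquad[\hat f^K]_e=\sum_m[\hat f^K]_e^m.$$ *)

theory Defs
  imports "HOL-Analysis.Analysis" "Graph_Theory.Arc_Walk"
begin

section \<open>The combined distribution--modal split--assignment model\<close>

datatype congestion_model = Beckmann | Stable_Dynamics

text \<open>
  Links are the elements of the finite type \<open>'e\<close>, so that vectors over the links live in
  \<open>real ^ 'e\<close>; trip purposes, agent types and modes are the elements of the finite types
  \<open>'r\<close>, \<open>'a\<close> and \<open>'m\<close>. Origins and destinations are sets of vertices.
  Functions of an origin or a destination are only ever read on these sets.
\<close>

record ('v, 'e, 'r, 'a, 'm) traffic_problem =
  network :: "('v, 'e) pre_digraph"
  origins :: "'v set"
  dests :: "'v set"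
  paths :: "'v \<Rightarrow> 'v \<Rightarrow> 'm \<Rightarrow> 'e list set"
  tbar :: "real ^ 'e"
  fbar :: "real ^ 'e"
  mode_cost :: "'e \<Rightarrow> 'm \<Rightarrow> real"
  alpha :: "'a \<Rightarrow> real"
  beta :: "'a \<Rightarrow> 'm \<Rightarrow> real"
  gamma :: "'r \<Rightarrow> real"
  rho :: real
  mu :: real
  departures :: "'v \<Rightarrow> 'r \<Rightarrow> 'a \<Rightarrow> real"  \<comment> \<open>\<open>l\<close>\<close>
  arrivals :: "'v \<Rightarrow> 'r \<Rightarrow> real"  \<comment> \<open>\<open>w\<close>\<close>
  congestion :: congestion_model

type_synonym ('v, 'r, 'a) demand = "'v \<Rightarrow> 'v \<Rightarrow> 'r \<Rightarrow> 'a \<Rightarrow> real"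
type_synonym ('v, 'r, 'a, 'm) mode_demand = "'v \<Rightarrow> 'v \<Rightarrow> 'r \<Rightarrow> 'a \<Rightarrow> 'm \<Rightarrow> real"

definition total_demand :: "('v, 'e::finite, 'r::finite, 'a::finite, 'm::finite) traffic_problem \<Rightarrow> real" where
  "total_demand I = (\<Sum>r\<in>UNIV. \<Sum>j\<in>dests I. arrivals I j r)"

definition well_posed :: "('v, 'e::finite, 'r::finite, 'a::finite, 'm::finite) traffic_problem \<Rightarrow> bool" where
  "well_posed I \<longleftrightarrow>
     fin_digraph (network I) \<and> arcs (network I) = UNIV \<and>
     origins I \<subseteq> verts (network I) \<and> dests I \<subseteq> verts (network I) \<and>
     (\<forall>i\<in>origins I. \<forall>j\<in>dests I. \<forall>m. paths I i j m \<noteq> {} \<and>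
        paths I i j m \<subseteq> {p. pre_digraph.apath (network I) i p j}) \<and>
     (\<forall>e. 0 < tbar I $ e \<and> 0 < fbar I $ e) \<and> (\<forall>e m. 0 \<le> mode_cost I e m) \<and>
     (\<forall>a. 0 < alpha I a) \<and> (\<forall>r. 0 < gamma I r) \<and> 0 < rho I \<and> 0 < mu I \<and>
     (\<forall>i\<in>origins I. \<forall>r a. 0 \<le> departures I i r a) \<and>
     (\<forall>j\<in>dests I. \<forall>r. 0 \<le> arrivals I j r) \<and>
     (\<forall>r. (\<Sum>i\<in>origins I. \<Sum>a\<in>UNIV. departures I i r a) = (\<Sum>j\<in>dests I. arrivals I j r)) \<and>
     0 < total_demand I"

definition max_links :: "('v, 'e::finite, 'r::finite, 'a::finite, 'm::finite) traffic_problem \<Rightarrow> nat" where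
  "max_links I = Max {length p |u p v. pre_digraph.apath (network I) u p v}"


subsection \<open>Demand and flows\<close>

definition trip_tables :: "('v, 'e::finite, 'r::finite, 'a::finite, 'm::finite) traffic_problem
    \<Rightarrow> ('v, 'r, 'a) demand set" where
  "trip_tables I = {d.
     (\<forall>i\<in>origins I. \<forall>j\<in>dests I. \<forall>r a. 0 \<le> d i j r a) \<and>
     (\<forall>i\<in>origins I. \<forall>r a. (\<Sum>j\<in>dests I. d i j r a) = departures I i r a) \<and>
     (\<forall>j\<in>dests I. \<forall>r. (\<Sum>i\<in>origins I. \<Sum>a\<in>UNIV. d i j r a) = arrivals I j r)}"

text \<open>
  A path flow is indexed by its origin and destination as well as by the path: an
  empty path from a vertex to itself does not determine that vertex.
\<close>

definition path_flows :: "('v, 'e::finite, 'r::finite, 'a::finite, 'm::finite) traffic_problem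
    \<Rightarrow> ('v, 'r, 'a, 'm) mode_demand \<Rightarrow> ('v \<Rightarrow> 'v \<Rightarrow> 'r \<Rightarrow> 'a \<Rightarrow> 'm \<Rightarrow> 'e list \<Rightarrow> real) set" where
  "path_flows I d = {x. \<forall>i\<in>origins I. \<forall>j\<in>dests I. \<forall>r a m.
     (\<forall>p\<in>paths I i j m. 0 \<le> x i j r a m p) \<and>
     (\<Sum>p\<in>paths I i j m. x i j r a m p) = d i j r a m}"

definition link_flows :: "('v, 'e::finite, 'r::finite, 'a::finite, 'm::finite) traffic_problem
    \<Rightarrow> ('v \<Rightarrow> 'v \<Rightarrow> 'r \<Rightarrow> 'a \<Rightarrow> 'm \<Rightarrow> 'e list \<Rightarrow> real) \<Rightarrow> 'm \<Rightarrow> real ^ 'e" where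
  "link_flows I x m = (\<chi> e. \<Sum>r\<in>UNIV. \<Sum>a\<in>UNIV. \<Sum>i\<in>origins I. \<Sum>j\<in>dests I.
     \<Sum>p\<in>{p\<in>paths I i j m. e \<in> set p}. x i j r a m p)"

definition total_flow :: "('m::finite \<Rightarrow> real ^ 'e::finite) \<Rightarrow> real ^ 'e" where
  "total_flow f = (\<Sum>m\<in>UNIV. f m)"


subsection \<open>Primal objective\<close>

definition link_time :: "('v, 'e::finite, 'r::finite, 'a::finite, 'm::finite) traffic_problem
    \<Rightarrow> 'e \<Rightarrow> real \<Rightarrow> real" where
  "link_time I e z = tbar I $ e * (1 + rho I * (z / fbar I $ e) powr (1 / mu I))"

definition sigma :: "('v, 'e::finite, 'r::finite, 'a::finite, 'm::finite) traffic_problem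
    \<Rightarrow> 'e \<Rightarrow> real \<Rightarrow> real" where
  "sigma I e z = (case congestion I of
       Beckmann \<Rightarrow> integral {0..z} (link_time I e)
     | Stable_Dynamics \<Rightarrow> tbar I $ e * z)"

definition Psi :: "('v, 'e::finite, 'r::finite, 'a::finite, 'm::finite) traffic_problem
    \<Rightarrow> ('m \<Rightarrow> real ^ 'e) \<Rightarrow> real" where
  "Psi I f = (\<Sum>e\<in>UNIV. sigma I e (total_flow f $ e) + (\<Sum>m\<in>UNIV. mode_cost I e m * f m $ e))"

text \<open>The convention \<open>0 ln 0 = 0\<close> holds because \<open>0 * x = 0\<close>; also \<open>x / 0 = 0\<close>.\<close>

definition entropy :: "('v, 'e::finite, 'r::finite, 'a::finite, 'm::finite) traffic_problem
    \<Rightarrow> ('v, 'r, 'a, 'm) mode_demand \<Rightarrow> real" where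
  "entropy I d =
     (\<Sum>i\<in>origins I. \<Sum>j\<in>dests I. \<Sum>r\<in>UNIV. \<Sum>a\<in>UNIV.
        1 / gamma I r * (\<Sum>m\<in>UNIV. d i j r a m) * ln (\<Sum>m\<in>UNIV. d i j r a m)) +
     (\<Sum>i\<in>origins I. \<Sum>j\<in>dests I. \<Sum>r\<in>UNIV. \<Sum>a\<in>UNIV. \<Sum>m\<in>UNIV.
        1 / alpha I a * d i j r a m *
          (ln (d i j r a m / (\<Sum>m'\<in>UNIV. d i j r a m')) + beta I a m))"

definition P3 :: "('v, 'e::finite, 'r::finite, 'a::finite, 'm::finite) traffic_problem
    \<Rightarrow> ('m \<Rightarrow> real ^ 'e) \<Rightarrow> ('v, 'r, 'a, 'm) mode_demand \<Rightarrow> real" where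
  "P3 I f d = Psi I f + entropy I d"


subsection \<open>Dual objective\<close>

definition sigma_conj :: "('v, 'e::finite, 'r::finite, 'a::finite, 'm::finite) traffic_problem
    \<Rightarrow> 'e \<Rightarrow> real \<Rightarrow> real" where
  "sigma_conj I e \<theta> = (SUP z\<in>{0..}. \<theta> * z - sigma I e z)"

text \<open>The value of \<open>h\<close> on its domain \<open>dom_h\<close>; outside it, \<open>h_fun\<close> is irrelevant.\<close>

definition h_fun :: "('v, 'e::finite, 'r::finite, 'a::finite, 'm::finite) traffic_problem
    \<Rightarrow> real ^ 'e \<Rightarrow> real" where
  "h_fun I t = (case congestion I of
       Beckmann \<Rightarrow> (\<Sum>e\<in>UNIV. sigma_conj I e (t $ e))
     | Stable_Dynamics \<Rightarrow> (t - tbar I) \<bullet> fbar I)"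

definition dom_h :: "('v, 'e::finite, 'r::finite, 'a::finite, 'm::finite) traffic_problem
    \<Rightarrow> (real ^ 'e) set" where
  "dom_h I = {t. \<forall>e. tbar I $ e \<le> t $ e}"

definition path_cost :: "('v, 'e::finite, 'r::finite, 'a::finite, 'm::finite) traffic_problem
    \<Rightarrow> real ^ 'e \<Rightarrow> 'm \<Rightarrow> 'e list \<Rightarrow> real" where
  "path_cost I t m p = (\<Sum>e\<in>set p. t $ e + mode_cost I e m)"

definition mode_time :: "('v, 'e::finite, 'r::finite, 'a::finite, 'm::finite) traffic_problem
    \<Rightarrow> real ^ 'e \<Rightarrow> 'v \<Rightarrow> 'v \<Rightarrow> 'm \<Rightarrow> real" where
  "mode_time I t i j m = Min (path_cost I t m ` paths I i j m)"

definition agent_time :: "('v, 'e::finite, 'r::finite, 'a::finite, 'm::finite) traffic_problem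
    \<Rightarrow> real ^ 'e \<Rightarrow> 'v \<Rightarrow> 'v \<Rightarrow> 'a \<Rightarrow> real" where
  "agent_time I t i j a =
     - (1 / alpha I a) * ln (\<Sum>m\<in>UNIV. exp (- alpha I a * mode_time I t i j m - beta I a m))"

definition E_fun :: "('v, 'e::finite, 'r::finite, 'a::finite, 'm::finite) traffic_problem
    \<Rightarrow> ('v, 'r, 'a) demand \<Rightarrow> real ^ 'e \<Rightarrow> real" where
  "E_fun I d t =
     (\<Sum>i\<in>origins I. \<Sum>j\<in>dests I. \<Sum>r\<in>UNIV. \<Sum>a\<in>UNIV. d i j r a * agent_time I t i j a) +
     (\<Sum>i\<in>origins I. \<Sum>j\<in>dests I. \<Sum>r\<in>UNIV. \<Sum>a\<in>UNIV. 1 / gamma I r * d i j r a * ln (d i j r a))"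

text \<open>The infimum below is a minimum: \<open>E_fun\<close> is continuous in the demand on a compact polytope.\<close>

definition E_min :: "('v, 'e::finite, 'r::finite, 'a::finite, 'm::finite) traffic_problem
    \<Rightarrow> real ^ 'e \<Rightarrow> real" where
  "E_min I t = (INF d\<in>trip_tables I. E_fun I d t)"

definition phi3 :: "('v, 'e::finite, 'r::finite, 'a::finite, 'm::finite) traffic_problem
    \<Rightarrow> real ^ 'e \<Rightarrow> real" where
  "phi3 I t = - E_min I t"

definition D3 :: "('v, 'e::finite, 'r::finite, 'a::finite, 'm::finite) traffic_problem
    \<Rightarrow> real ^ 'e \<Rightarrow> real" where
  "D3 I t = - phi3 I t - h_fun I t"


subsection \<open>Inexact solver of the inner problem\<close>

definition mode_split :: "('v, 'e::finite, 'r::finite, 'a::finite, 'm::finite) traffic_problem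
    \<Rightarrow> real ^ 'e \<Rightarrow> ('v, 'r, 'a) demand \<Rightarrow> ('v, 'r, 'a, 'm) mode_demand" where
  "mode_split I t d i j r a m =
     d i j r a * (exp (- alpha I a * mode_time I t i j m - beta I a m) /
       (\<Sum>m'\<in>UNIV. exp (- alpha I a * mode_time I t i j m' - beta I a m')))"

text \<open>The mode-specific link flows that arise by sending \<open>d\<close> along shortest paths for times \<open>t\<close>.\<close>

definition shortest_path_flows :: "('v, 'e::finite, 'r::finite, 'a::finite, 'm::finite) traffic_problem
    \<Rightarrow> real ^ 'e \<Rightarrow> ('v, 'r, 'a, 'm) mode_demand \<Rightarrow> ('m \<Rightarrow> real ^ 'e) set" where
  "shortest_path_flows I t d = {link_flows I x |x. x \<in> path_flows I d \<and>
     (\<forall>i\<in>origins I. \<forall>j\<in>dests I. \<forall>r a m. \<forall>p\<in>paths I i j m.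
        x i j r a m p \<noteq> 0 \<longrightarrow> path_cost I t m p = mode_time I t i j m)}"

text \<open>
  A reply of the inexact solver of \<open>min E_fun\<close> consists of the approximate trip table and of the supergradient
  of \<open>E_fun\<close> in the times, that is, the total link flows.
\<close>

type_synonym ('v, 'e, 'r, 'a) reply = "('v, 'r, 'a) demand \<times> (real ^ 'e)"

definition oracle_replies :: "('v, 'e::finite, 'r::finite, 'a::finite, 'm::finite) traffic_problem
    \<Rightarrow> real \<Rightarrow> real ^ 'e \<Rightarrow> ('v, 'e, 'r, 'a) reply set" where
  "oracle_replies I \<delta> t = {(d, g). d \<in> trip_tables I \<and> E_fun I d t \<le> E_min I t + \<delta> \<and>
     g \<in> total_flow ` shortest_path_flows I t (mode_split I t d)}"


section \<open>Universal method of similar triangles\<close>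

text \<open>
  State after \<open>k\<close> iterations: \<open>lip\<close>, \<open>step\<close>, \<open>weight\<close>, \<open>y_pt\<close>, \<open>u_pt\<close>, \<open>t_pt\<close>, \<open>model\<close> stand for
  \<open>L\<^sub>k\<close>, \<open>s\<^sub>k\<close>, \<open>A\<^sub>k\<close>, \<open>y\<^sup>k\<close>, \<open>u\<^sup>k\<close>, \<open>t\<^sup>k\<close>, \<open>\<phi>\<^sub>k\<close>, and \<open>trial\<close> is the number of rejected trials of the last
  iteration. In the initial state \<open>step\<close>, \<open>y_pt\<close> and \<open>trial\<close> are dummies.
\<close>

record 'x ustm_state =
  lip :: real
  step :: real
  weight :: real
  y_pt :: 'x
  u_pt :: 'x
  t_pt :: 'x
  model :: "'x \<Rightarrow> real"
  trial :: nat

definition ustm_init :: "'x::real_inner \<Rightarrow> real \<Rightarrow> 'x ustm_state" where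
  "ustm_init t0 L0 = \<lparr>lip = L0, step = 0, weight = 0, y_pt = t0, u_pt = t0, t_pt = t0,
     model = (\<lambda>t. 1/2 * (norm (t - t0))\<^sup>2), trial = 0\<rparr>"

text \<open>
  Trial \<open>j\<close> from the state \<open>S\<close>, where \<open>F\<close> and \<open>G\<close> are the value and the gradient returned by
  the inexact solver during that trial, and \<open>Q\<close> is the domain of \<open>h\<close>.
\<close>

definition ustm_trial :: "('x::real_inner \<Rightarrow> real) \<Rightarrow> 'x set \<Rightarrow> ('x \<Rightarrow> real) \<Rightarrow> ('x \<Rightarrow> 'x)
    \<Rightarrow> 'x ustm_state \<Rightarrow> nat \<Rightarrow> 'x ustm_state" where
  "ustm_trial h Q F G S j =
    (let L = 2 ^ j * (lip S / 2);
         s = 1 / (2 * L) + sqrt (1 / (4 * L\<^sup>2) + weight S / L);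
         A = weight S + s;
         y = (s *\<^sub>R u_pt S + weight S *\<^sub>R t_pt S) /\<^sub>R A;
         \<phi> = (\<lambda>t. model S t + s * (F y + G y \<bullet> (t - y) + h t));
         u = arg_min_on \<phi> Q;
         t = (s *\<^sub>R u + weight S *\<^sub>R t_pt S) /\<^sub>R A
     in \<lparr>lip = L, step = s, weight = A, y_pt = y, u_pt = u, t_pt = t, model = \<phi>, trial = j\<rparr>)"

definition ustm_accept :: "real \<Rightarrow> ('x::real_inner \<Rightarrow> real) \<Rightarrow> ('x \<Rightarrow> 'x) \<Rightarrow> 'x ustm_state \<Rightarrow> bool" where
  "ustm_accept \<epsilon> F G S \<longleftrightarrow>
     F (t_pt S) \<le> F (y_pt S) + G (y_pt S) \<bullet> (t_pt S - y_pt S)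
       + lip S / 2 * (norm (t_pt S - y_pt S))\<^sup>2 + step S / (2 * weight S) * \<epsilon>"

text \<open>
  The solver may answer differently in every trial \<open>j\<close> of every iteration \<open>k\<close>, hence the
  two indices of \<open>F\<close> and \<open>G\<close>.
\<close>

primrec ustm :: "('x::real_inner \<Rightarrow> real) \<Rightarrow> 'x set \<Rightarrow> 'x \<Rightarrow> real \<Rightarrow> real
    \<Rightarrow> (nat \<Rightarrow> nat \<Rightarrow> 'x \<Rightarrow> real) \<Rightarrow> (nat \<Rightarrow> nat \<Rightarrow> 'x \<Rightarrow> 'x) \<Rightarrow> nat \<Rightarrow> 'x ustm_state" where
  "ustm h Q t0 L0 \<epsilon> F G 0 = ustm_init t0 L0"
| "ustm h Q t0 L0 \<epsilon> F G (Suc k) =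
     (let T = (\<lambda>j. ustm_trial h Q (F k j) (G k j) (ustm h Q t0 L0 \<epsilon> F G k) j)
      in T (LEAST j. ustm_accept \<epsilon> (F k j) (G k j) (T j)))"


subsection \<open>Application to the dual problem\<close>

type_synonym ('v, 'e, 'r, 'a) oracle_fun = "nat \<Rightarrow> nat \<Rightarrow> real ^ 'e \<Rightarrow> ('v, 'e, 'r, 'a) reply"

definition oracle_val :: "('v, 'e::finite, 'r::finite, 'a::finite, 'm::finite) traffic_problem
    \<Rightarrow> ('v, 'e, 'r, 'a) oracle_fun \<Rightarrow> nat \<Rightarrow> nat \<Rightarrow> real ^ 'e \<Rightarrow> real" where
  "oracle_val I orc k j t = - E_fun I (fst (orc k j t)) t"

definition oracle_grad :: "('v, 'e::finite, 'r, 'a) oracle_fun \<Rightarrow> nat \<Rightarrow> nat \<Rightarrow> real ^ 'e \<Rightarrow> real ^ 'e" where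
  "oracle_grad orc k j t = - snd (orc k j t)"

definition run :: "('v, 'e::finite, 'r::finite, 'a::finite, 'm::finite) traffic_problem
    \<Rightarrow> ('v, 'e, 'r, 'a) oracle_fun \<Rightarrow> real ^ 'e \<Rightarrow> real \<Rightarrow> real \<Rightarrow> nat \<Rightarrow> (real ^ 'e) ustm_state" where
  "run I orc t0 L0 \<epsilon> = ustm (h_fun I) (dom_h I) t0 L0 \<epsilon> (oracle_val I orc) (oracle_grad orc)"

definition run_trial :: "('v, 'e::finite, 'r::finite, 'a::finite, 'm::finite) traffic_problem
    \<Rightarrow> ('v, 'e, 'r, 'a) oracle_fun \<Rightarrow> real ^ 'e \<Rightarrow> real \<Rightarrow> real \<Rightarrow> nat \<Rightarrow> nat \<Rightarrow> (real ^ 'e) ustm_state" where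
  "run_trial I orc t0 L0 \<epsilon> k j = ustm_trial (h_fun I) (dom_h I)
     (oracle_val I orc k j) (oracle_grad orc k j) (run I orc t0 L0 \<epsilon> k) j"

text \<open>
  Trial \<open>j\<close> of iteration \<open>k\<close> takes place iff all the earlier ones were rejected. It calls the inexact
  solver at its points \<open>y\<close> and \<open>t\<close>, with the accuracy prescribed by its own \<open>step\<close> and \<open>weight\<close>.
\<close>

definition oracle_accurate :: "('v, 'e::finite, 'r::finite, 'a::finite, 'm::finite) traffic_problem
    \<Rightarrow> ('v, 'e, 'r, 'a) oracle_fun \<Rightarrow> real ^ 'e \<Rightarrow> real \<Rightarrow> real \<Rightarrow> bool" where
  "oracle_accurate I orc t0 L0 \<epsilon> \<longleftrightarrow>
     (\<forall>k j. let S = run_trial I orc t0 L0 \<epsilon> k j in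
        (\<forall>j'<j. \<not> ustm_accept \<epsilon> (oracle_val I orc k j') (oracle_grad orc k j')
                     (run_trial I orc t0 L0 \<epsilon> k j')) \<longrightarrow>
        (\<forall>t\<in>{y_pt S, t_pt S}.
           orc k j t \<in> oracle_replies I (step S * \<epsilon> / (4 * weight S)) t))"


subsection \<open>Primal reconstruction\<close>

text \<open>
  For \<open>k \<ge> 1\<close>: the reply of the solver at \<open>y\<^sup>k\<close> (given in the accepted trial of the iteration that
  produced \<open>y\<^sup>k\<close>), and the corresponding trip matrix \<open>d'(y\<^sup>k)\<close>.
\<close>

definition reply_at :: "('v, 'e::finite, 'r::finite, 'a::finite, 'm::finite) traffic_problem
    \<Rightarrow> ('v, 'e, 'r, 'a) oracle_fun \<Rightarrow> real ^ 'e \<Rightarrow> real \<Rightarrow> real \<Rightarrow> nat \<Rightarrow> ('v, 'e, 'r, 'a) reply" where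
  "reply_at I orc t0 L0 \<epsilon> k =
     (let S = run I orc t0 L0 \<epsilon> k in orc (k - 1) (trial S) (y_pt S))"

definition trips_at :: "('v, 'e::finite, 'r::finite, 'a::finite, 'm::finite) traffic_problem
    \<Rightarrow> ('v, 'e, 'r, 'a) oracle_fun \<Rightarrow> real ^ 'e \<Rightarrow> real \<Rightarrow> real \<Rightarrow> nat \<Rightarrow> ('v, 'r, 'a, 'm) mode_demand" where
  "trips_at I orc t0 L0 \<epsilon> k =
     mode_split I (y_pt (run I orc t0 L0 \<epsilon> k)) (fst (reply_at I orc t0 L0 \<epsilon> k))"

definition d_hat :: "('v, 'e::finite, 'r::finite, 'a::finite, 'm::finite) traffic_problem
    \<Rightarrow> ('v, 'e, 'r, 'a) oracle_fun \<Rightarrow> real ^ 'e \<Rightarrow> real \<Rightarrow> real \<Rightarrow> nat \<Rightarrow> ('v, 'r, 'a, 'm) mode_demand" where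
  "d_hat I orc t0 L0 \<epsilon> K i j r a m =
     1 / weight (run I orc t0 L0 \<epsilon> K) *
       (\<Sum>k=1..K. step (run I orc t0 L0 \<epsilon> k) * trips_at I orc t0 L0 \<epsilon> k i j r a m)"

definition f_hat :: "('v, 'e::finite, 'r::finite, 'a::finite, 'm::finite) traffic_problem
    \<Rightarrow> ('v, 'e, 'r, 'a) oracle_fun \<Rightarrow> real ^ 'e \<Rightarrow> real \<Rightarrow> real \<Rightarrow> (nat \<Rightarrow> 'm \<Rightarrow> real ^ 'e)
    \<Rightarrow> nat \<Rightarrow> 'm \<Rightarrow> real ^ 'e" where
  "f_hat I orc t0 L0 \<epsilon> f K m =
     (1 / weight (run I orc t0 L0 \<epsilon> K)) *\<^sub>R
       (\<Sum>k=1..K. step (run I orc t0 L0 \<epsilon> k) *\<^sub>R f k m)"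

definition pos_part :: "real ^ 'e::finite \<Rightarrow> real ^ 'e" where
  "pos_part x = (\<chi> e. max (x $ e) 0)"


section \<open>Constants of the complexity bounds\<close>

definition M_const :: "('v, 'e::finite, 'r::finite, 'a::finite, 'm::finite) traffic_problem \<Rightarrow> real" where
  "M_const I = sqrt (2 * real (max_links I)) * total_demand I"

definition R_tilde :: "('v, 'e::finite, 'r::finite, 'a::finite, 'm::finite) traffic_problem \<Rightarrow> real" where
  "R_tilde I = sqrt ((rho I)\<^sup>2 * total_demand I powr (2 / mu I) *
     (\<Sum>e\<in>UNIV. (tbar I $ e)\<^sup>2 / (fbar I $ e) powr (2 / mu I)))"

end

theory Submission
  imports Defs
begin

text \<open>
  Write \<open>\<Lambda>(t, f, d)\<close> for the entropy of \<open>d\<close> plus the cost of the flows \<open>f\<close> at times \<open>t\<close>. By Gibbs'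
  variational principle \<open>E(d, T(t)) \<le> \<Lambda>(t, f, d)\<close> for every flow serving \<open>d\<close>, with equality for the
  logit split along shortest paths. Hence the solver's replies form an inexact first-order oracle for
  \<open>\<phi>\<^sub>3\<close>, the linear models accumulated by the method are \<open>- \<Lambda>(\<cdot>, f\<^sup>k, d\<^sup>k)\<close>, and by the log-sum
  inequality their average is at most \<open>- \<Lambda>(\<cdot>, f\<^sub>K, d\<^sub>K)\<close> at the reconstructed averages. The similar
  triangles certificate, evaluated at the link times of the averaged flow (Beckmann) or at
  \<open>tbar + A\<^sub>K (f\<^sub>K - fbar)\<^sub>+\<close> (Stable Dynamics), bounds the duality gap.

  With \<open>c = \<epsilon> / (4 M\<^sup>2)\<close> every step is at least \<open>c\<close>, so \<open>A\<^sub>K \<ge> K c\<close>. The slack of the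
  acceptance test and the error of the solver add up to \<open>3/4 \<epsilon>\<close>, which together with
  \<open>A\<^sub>K = K c\<close> would not give \<open>\<epsilon>\<close>; but short steps also commit smaller errors, and the total is at most
  \<open>\<epsilon> (A\<^sub>K - 5/8 K c)\<close>. For the excess flow the bound \<open>A\<^sub>K \<ge> 5/4 K c\<close>, valid for \<open>K \<ge> 18\<close>, is
  used; for smaller \<open>K\<close> the flow itself is already small enough.
\<close>

section \<open>Minimizing strongly convex functions\<close>

text \<open>A sublevel set is closed and lies in a ball, because \<open>h\<close> is nonnegative and
  the quadratic part grows; this gives a minimizer. The growth bound comes from comparing the
  minimizer \<open>u\<close> with the points \<open>z u + (1 - z) t\<close> and letting
  \<open>z\<close> tend to 1.\<close>

lemma strongly_convex_arg_min:
  fixes \<phi> h :: "'x::euclidean_space \<Rightarrow> real"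
  assumes \<phi>: "\<And>t. \<phi> t = (norm (t - t0))\<^sup>2 / 2 + a + b \<bullet> t + A * h t"
    and A: "0 \<le> A" and h: "convex_on Q h" "continuous_on Q h" "\<And>t. t \<in> Q \<Longrightarrow> 0 \<le> h t"
    and Q: "closed Q" "Q \<noteq> {}"
  shows "arg_min_on \<phi> Q \<in> Q"
    and "t \<in> Q \<Longrightarrow> \<phi> (arg_min_on \<phi> Q) + (norm (t - arg_min_on \<phi> Q))\<^sup>2 / 2 \<le> \<phi> t"
proof -
  \<comment> \<open>Completing the square: the linear term moves the centre from \<open>t0\<close>
    to \<open>w\<close>, and \<open>\<kappa>\<close> collects the constants.\<close>
  define w where "w = t0 - b"
  define \<kappa> where "\<kappa> = a + b \<bullet> t0 - (norm b)\<^sup>2 / 2"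
  have \<phi>': "\<phi> t = (norm (t - w))\<^sup>2 / 2 + \<kappa> + A * h t" for t
    unfolding \<phi> w_def \<kappa>_def power2_norm_eq_inner
    by (simp add: inner_diff inner_add inner_commute field_simps)
  obtain q where q: "q \<in> Q" using Q by auto
  define r where "r = sqrt (2 * (\<phi> q - \<kappa>))"
  have lower: "(norm (t - w))\<^sup>2 / 2 + \<kappa> \<le> \<phi> t" if "t \<in> Q" for t
    using \<phi>' A h(3)[OF that] by simp
  have in_ball: "t \<in> cball w r" if "t \<in> Q" "\<phi> t \<le> \<phi> q" for t
  proof -
    have "(norm (t - w))\<^sup>2 \<le> 2 * (\<phi> q - \<kappa>)" using lower[OF that(1)] that(2) by simp
    then have "norm (t - w) \<le> r" unfolding r_def by (simp add: real_le_rsqrt)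
    then show ?thesis by (simp add: dist_norm norm_minus_commute)
  qed
  have cont: "continuous_on (Q \<inter> cball w r) \<phi>"
    unfolding \<phi>[abs_def]
    by (intro continuous_intros continuous_on_subset[OF h(2)]) auto
  have "compact (Q \<inter> cball w r)" using Q by (simp add: closed_Int_compact)
  moreover have "q \<in> Q \<inter> cball w r" using q in_ball by auto
  ultimately obtain v where v: "v \<in> Q \<inter> cball w r" "\<And>t. t \<in> Q \<inter> cball w r \<Longrightarrow> \<phi> v \<le> \<phi> t"
    using continuous_attains_inf[of "Q \<inter> cball w r" \<phi>] cont by blast
  have "\<phi> v \<le> \<phi> t" if "t \<in> Q" for t
  proof (cases "\<phi> t \<le> \<phi> q")
    case True then show ?thesis using v(2) in_ball that by blast
  next
    case False
    moreover have "\<phi> v \<le> \<phi> q" using v(2) \<open>q \<in> Q \<inter> cball w r\<close> by blast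
    ultimately show ?thesis by simp
  qed
  then have "is_arg_min \<phi> (\<lambda>x. x \<in> Q) v" using v(1) unfolding is_arg_min_def by force
  \<comment> \<open>\<open>arg_min_on\<close> is a Hilbert choice, hence a minimizer as soon as one
    exists.\<close>
  then have "is_arg_min \<phi> (\<lambda>x. x \<in> Q) (arg_min_on \<phi> Q)"
    unfolding arg_min_on_def arg_min_def by (rule someI)
  then have u: "arg_min_on \<phi> Q \<in> Q" "\<And>t. t \<in> Q \<Longrightarrow> \<phi> (arg_min_on \<phi> Q) \<le> \<phi> t"
    unfolding is_arg_min_def by force+
  show "arg_min_on \<phi> Q \<in> Q" by (rule u)
  define u where "u = arg_min_on \<phi> Q"
  show "\<phi> (arg_min_on \<phi> Q) + (norm (t - arg_min_on \<phi> Q))\<^sup>2 / 2 \<le> \<phi> t" if t: "t \<in> Q"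
  proof -
    let ?D = "(norm (t - u))\<^sup>2 / 2"
    have "z * ?D \<le> \<phi> t - \<phi> u" if z: "0 < z" "z < 1" for z
    proof -
      define x where "x = z *\<^sub>R u + (1 - z) *\<^sub>R t"
      have "x \<in> Q" using h(1) u(1) t z unfolding convex_on_def x_def u_def
        by (intro convexD) auto
      then have "\<phi> u \<le> \<phi> x" unfolding u_def by (rule u(2))
      moreover have "h x \<le> z * h u + (1 - z) * h t"
        using convex_onD[OF h(1), of "1 - z" u t] u(1) t z unfolding x_def u_def by simp
      then have "A * h x \<le> A * (z * h u + (1 - z) * h t)" using A by (rule mult_left_mono)
      moreover have "(norm (x - w))\<^sup>2 = z * (norm (u - w))\<^sup>2 + (1 - z) * (norm (t - w))\<^sup>2
          - z * (1 - z) * (norm (t - u))\<^sup>2"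
        unfolding x_def power2_norm_eq_inner
        by (simp add: inner_diff inner_add inner_commute algebra_simps)
      moreover have "\<phi> x = (norm (x - w))\<^sup>2 / 2 + \<kappa> + A * h x"
        "z * \<phi> u = z * (norm (u - w))\<^sup>2 / 2 + z * \<kappa> + A * (z * h u)"
        "(1 - z) * \<phi> t = (1 - z) * (norm (t - w))\<^sup>2 / 2 + (1 - z) * \<kappa> + A * ((1 - z) * h t)"
        unfolding \<phi>' by (simp_all add: algebra_simps)
      ultimately have "\<phi> u \<le> z * \<phi> u + (1 - z) * \<phi> t - z * (1 - z) * ?D"
        by (simp add: algebra_simps add_divide_distrib diff_divide_distrib)
      then have "(1 - z) * (z * ?D) \<le> (1 - z) * (\<phi> t - \<phi> u)"
        by (simp add: algebra_simps)
      then show ?thesis using z by (simp add: mult_le_cancel_left)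
    qed
    then have "?D \<le> \<phi> t - \<phi> u" by (rule field_le_mult_one_interval)
    then show ?thesis unfolding u_def by simp
  qed
qed

section \<open>Similar triangles with an inexact oracle\<close>

declare ustm.simps(2) [simp del]

text \<open>The nonsmooth form of an inexact first-order oracle: an exact affine minorant, and an
  upper bound whose growth is linear with slope \<open>M\<close> since the gradients only have
  bounded variation.\<close>

definition inexact_oracle_at ::
    "('x::real_inner \<Rightarrow> real) \<Rightarrow> real \<Rightarrow> real \<Rightarrow> real \<Rightarrow> 'x \<Rightarrow> 'x \<Rightarrow> bool" where
  "inexact_oracle_at \<Phi> M \<delta> v g z \<longleftrightarrow>
     (\<forall>t. v + g \<bullet> (t - z) \<le> \<Phi> t \<and> \<Phi> t \<le> v + g \<bullet> (t - z) + M * norm (t - z) + \<delta>)"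

text \<open>\<open>L x^2 - x - A\<close> factors as \<open>(x - s) (L (x + s) - 1)\<close>, and
  \<open>L s \<ge> 1\<close> makes the second factor positive. Steps are compared with multiples of
  \<open>c\<close> through this criterion, without touching the square root.\<close>

lemma le_quadratic_root_iff:
  fixes L :: real
  assumes L: "0 < L" and A: "0 \<le> A" and s: "0 < s" "L * s\<^sup>2 = A + s" and x: "0 < x"
  shows "x \<le> s \<longleftrightarrow> L * x\<^sup>2 \<le> A + x"
proof -
  have gap: "L * x\<^sup>2 - x - A = (x - s) * (L * (x + s) - 1)"
    using s by (simp add: power2_eq_square algebra_simps)
  have "s * (L * s) \<ge> s * 1" using s A by (simp add: power2_eq_square algebra_simps)
  then have "L * s \<ge> 1" using s(1) by (subst (asm) mult_le_cancel_left_pos)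
  moreover have "L * x > 0" using L x by simp
  ultimately have "0 < L * (x + s) - 1" unfolding distrib_left by linarith
  then have "(x - s) * (L * (x + s) - 1) \<le> 0 \<longleftrightarrow> x \<le> s"
    by (simp add: mult_le_0_iff)
  then show ?thesis using gap by linarith
qed

text \<open>From here on the step is known only as the positive root of \<open>L s^2 = A\<close>,
  where \<open>A\<close> is the new weight, and the points \<open>y\<close> and \<open>t\<close>
  through identities free of division.\<close>

lemma ustm_trial_simps:
  fixes S T :: "'x::real_inner ustm_state"
  assumes "0 < lip S" "0 \<le> weight S" and T_def: "T = ustm_trial h Q F G S j"
  shows "lip T = 2 ^ j * (lip S / 2)" "0 < lip T" "0 < step T"
    "weight T = weight S + step T" "lip T * (step T)\<^sup>2 = weight T"
    "weight T *\<^sub>R y_pt T = step T *\<^sub>R u_pt S + weight S *\<^sub>R t_pt S"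
    "weight T *\<^sub>R t_pt T = step T *\<^sub>R u_pt T + weight S *\<^sub>R t_pt S"
    "model T = (\<lambda>t. model S t + step T * (F (y_pt T) + G (y_pt T) \<bullet> (t - y_pt T) + h t))"
    "u_pt T = arg_min_on (model T) Q" "trial T = j"
proof -
  define L where "L = 2 ^ j * (lip S / 2)"
  have L: "0 < L" using assms by (simp add: L_def)
  define s where "s = 1 / (2 * L) + sqrt (1 / (4 * L\<^sup>2) + weight S / L)"
  have s: "0 < s" unfolding s_def using L assms by (intro add_pos_nonneg) auto
  have rad: "0 \<le> 1 / (4 * L\<^sup>2) + weight S / L" using L assms by simp
  have "(s - 1 / (2 * L))\<^sup>2 = 1 / (4 * L\<^sup>2) + weight S / L" unfolding s_def using rad by simp
  then have "L * (s - 1 / (2 * L))\<^sup>2 = L * (1 / (4 * L\<^sup>2) + weight S / L)" by simp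
  moreover have "L * (s - 1 / (2 * L))\<^sup>2 = L * s\<^sup>2 - s + 1 / (4 * L)"
    using L by (simp add: power2_diff power2_eq_square field_simps)
  moreover have "L * (1 / (4 * L\<^sup>2) + weight S / L) = 1 / (4 * L) + weight S"
    using L by (simp add: power2_eq_square field_simps)
  ultimately have quad: "L * s\<^sup>2 = weight S + s" by linarith
  have T: "lip T = L" "step T = s" "weight T = weight S + s" "trial T = j"
    "y_pt T = (s *\<^sub>R u_pt S + weight S *\<^sub>R t_pt S) /\<^sub>R (weight S + s)"
    "t_pt T = (s *\<^sub>R u_pt T + weight S *\<^sub>R t_pt S) /\<^sub>R (weight S + s)"
    "model T = (\<lambda>t. model S t + step T * (F (y_pt T) + G (y_pt T) \<bullet> (t - y_pt T) + h t))"
    "u_pt T = arg_min_on (model T) Q"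
    unfolding T_def ustm_trial_def Let_def s_def L_def by simp_all
  have "weight S + s \<noteq> 0" using s assms by simp
  then show "weight T *\<^sub>R y_pt T = step T *\<^sub>R u_pt S + weight S *\<^sub>R t_pt S"
    "weight T *\<^sub>R t_pt T = step T *\<^sub>R u_pt T + weight S *\<^sub>R t_pt S"
    using T by simp_all
  show "lip T * (step T)\<^sup>2 = weight T" using T(1-3) quad by simp
  show "lip T = 2 ^ j * (lip S / 2)" "0 < lip T" "0 < step T"
    "weight T = weight S + step T"
    "model T = (\<lambda>t. model S t + step T * (F (y_pt T) + G (y_pt T) \<bullet> (t - y_pt T) + h t))"
    "u_pt T = arg_min_on (model T) Q" "trial T = j"
    using T L s by (simp_all add: L_def)
qed

lemma scaled_convex_combination_mem:
  assumes "convex Q" "x \<in> Q" "y \<in> Q \<or> b = 0" "0 < a" "0 \<le> b" "(a + b) *\<^sub>R z = a *\<^sub>R x + b *\<^sub>R y"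
  shows "z \<in> Q"
proof (cases "b = 0")
  case True
  then show ?thesis using assms by simp
next
  case False
  have "z = (1 / (a + b)) *\<^sub>R ((a + b) *\<^sub>R z)" using assms(4,5) by simp
  also have "\<dots> = (a / (a + b)) *\<^sub>R x + (b / (a + b)) *\<^sub>R y"
    unfolding assms(6) by (simp add: scaleR_add_right)
  also have "\<dots> \<in> Q"
    using assms False by (intro convexD) (auto simp flip: add_divide_distrib)
  finally show ?thesis .
qed

text \<open>The method separated from the traffic model. Accuracy is demanded only of trials that
  take place, that is, after all earlier trials of the iteration were rejected, and is measured by
  the trial's own step and weight.\<close>

locale inexact_ustm =
  fixes h \<Phi> :: "'x::euclidean_space \<Rightarrow> real" and Q :: "'x set" and t0 :: 'x
    and L0 \<epsilon> M :: real and F :: "nat \<Rightarrow> nat \<Rightarrow> 'x \<Rightarrow> real" and G :: "nat \<Rightarrow> nat \<Rightarrow> 'x \<Rightarrow> 'x"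
  assumes h: "convex_on Q h" "continuous_on Q h" "\<And>t. t \<in> Q \<Longrightarrow> 0 \<le> h t"
    and Q: "closed Q" "t0 \<in> Q"
    and eps: "0 < \<epsilon>" and M: "0 < M"
    and L0: "0 < L0" "L0 \<le> M\<^sup>2 / \<epsilon>"
    and replies: "\<And>k j z S. \<lbrakk>\<forall>j'<j. \<not> ustm_accept \<epsilon> (F k j') (G k j')
          (ustm_trial h Q (F k j') (G k j') (ustm h Q t0 L0 \<epsilon> F G k) j');
        S = ustm_trial h Q (F k j) (G k j) (ustm h Q t0 L0 \<epsilon> F G k) j; z \<in> {y_pt S, t_pt S}\<rbrakk>
      \<Longrightarrow> inexact_oracle_at \<Phi> M (step S * \<epsilon> / (4 * weight S)) (F k j z) (G k j z) z"
begin

section \<open>Trials, their errors and the step lengths\<close>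

abbreviation st :: "nat \<Rightarrow> 'x ustm_state" where
  "st \<equiv> ustm h Q t0 L0 \<epsilon> F G"

abbreviation tr :: "nat \<Rightarrow> nat \<Rightarrow> 'x ustm_state" where
  "tr k j \<equiv> ustm_trial h Q (F k j) (G k j) (st k) j"

abbreviation acc :: "nat \<Rightarrow> nat \<Rightarrow> bool" where
  "acc k j \<equiv> ustm_accept \<epsilon> (F k j) (G k j) (tr k j)"

text \<open>The unit of step length: a trial with step at most \<open>2 * c\<close> always passes
  the test, so backtracking cannot shrink a step below \<open>c\<close>.\<close>

definition c :: real where
  "c = \<epsilon> / (4 * M\<^sup>2)"

lemma c_pos: "0 < c"
  using eps M by (simp add: c_def)

lemma M_c: "M\<^sup>2 = \<epsilon> / (4 * c)"
  using eps M by (simp add: c_def)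

text \<open>The excess of linear over quadratic growth peaks at \<open>M^2 / (2 L)\<close>. Scaled
  by \<open>A = L s^2\<close> this is \<open>M^2 s^2 / 2\<close>, which no longer depends on
  \<open>L\<close>.\<close>

lemma scaled_peak_le:
  assumes "0 < L" "L * s\<^sup>2 = A"
  shows "A * (M * x - L / 2 * x\<^sup>2) \<le> \<epsilon> * s\<^sup>2 / (8 * c)"
proof -
  have "0 \<le> (L * x - M)\<^sup>2 * (s\<^sup>2 / 2)" by simp
  also have "\<dots> = s\<^sup>2 * M\<^sup>2 / 2 - L * s\<^sup>2 * (M * x - L / 2 * x\<^sup>2)"
    by (simp add: power2_eq_square field_simps)
  finally show ?thesis using assms M_c by (simp add: mult.commute)
qed

text \<open>The upper bound of the oracle at \<open>y\<close>, scaled by the weight: the solver's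
  accuracy contributes \<open>s \<epsilon> / 4\<close>, and trading the linear growth for the
  quadratic term costs the peak. Acceptance plays no part, so the bound serves rejected trials as
  well.\<close>

lemma trial_error:
  assumes S: "0 < lip (st k)" "0 \<le> weight (st k)"
    and rej: "\<forall>j'<j. \<not> acc k j'" and T: "T = tr k j"
  shows "weight T * \<Phi> (t_pt T) \<le> weight T * (F k j (y_pt T) + G k j (y_pt T) \<bullet> (t_pt T - y_pt T)
      + lip T / 2 * (norm (t_pt T - y_pt T))\<^sup>2) + step T * \<epsilon> / 4 + \<epsilon> * (step T)\<^sup>2 / (8 * c)"
proof -
  note ts = ustm_trial_simps[OF S T]
  let ?x = "norm (t_pt T - y_pt T)" and ?v = "F k j (y_pt T) + G k j (y_pt T) \<bullet> (t_pt T - y_pt T)"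
  have A: "0 < weight T" using ts S by linarith
  have "\<Phi> (t_pt T) \<le> ?v + M * ?x + step T * \<epsilon> / (4 * weight T)"
    using replies[OF rej T, of "y_pt T"] by (simp add: inexact_oracle_at_def)
  then have "weight T * \<Phi> (t_pt T) \<le> weight T * (?v + M * ?x + step T * \<epsilon> / (4 * weight T))"
    using A by simp
  also have "\<dots> = weight T * (?v + lip T / 2 * ?x\<^sup>2) + step T * \<epsilon> / 4
      + weight T * (M * ?x - lip T / 2 * ?x\<^sup>2)"
    using A by (simp add: field_simps)
  also have "\<dots> \<le> weight T * (?v + lip T / 2 * ?x\<^sup>2) + step T * \<epsilon> / 4 + \<epsilon> * (step T)\<^sup>2 / (8 * c)"
    using scaled_peak_le[OF ts(2,5), of ?x] by simp
  finally show ?thesis .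
qed

text \<open>For \<open>s \<le> 2 * c\<close> the peak is at most \<open>s \<epsilon> / 4\<close>.
  With the solver's \<open>s \<epsilon> / 4\<close> this makes \<open>s \<epsilon> / 2\<close>,
  exactly the scaled slack of the test; the reply at \<open>t_pt\<close> does not exceed
  \<open>\<Phi>\<close> there.\<close>

lemma small_step_accepted:
  assumes S: "0 < lip (st k)" "0 \<le> weight (st k)"
    and rej: "\<forall>j'<j. \<not> acc k j'" and small: "step (tr k j) \<le> 2 * c"
  shows "acc k j"
proof -
  define T where "T = tr k j"
  note ts = ustm_trial_simps[OF S T_def]
  let ?v = "F k j (y_pt T) + G k j (y_pt T) \<bullet> (t_pt T - y_pt T)
      + lip T / 2 * (norm (t_pt T - y_pt T))\<^sup>2"
  have A: "0 < weight T" using ts S by linarith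
  have "inexact_oracle_at \<Phi> M (step T * \<epsilon> / (4 * weight T)) (F k j (t_pt T)) (G k j (t_pt T)) (t_pt T)"
    using replies[OF rej T_def, of "t_pt T"] by simp
  then have "F k j (t_pt T) + G k j (t_pt T) \<bullet> (t_pt T - t_pt T) \<le> \<Phi> (t_pt T)"
    unfolding inexact_oracle_at_def by blast
  then have "weight T * F k j (t_pt T) \<le> weight T * \<Phi> (t_pt T)" using A by simp
  also have "\<dots> \<le> weight T * ?v + step T * \<epsilon> / 4 + \<epsilon> * (step T)\<^sup>2 / (8 * c)"
    using trial_error[OF S rej T_def] .
  also have "\<epsilon> * (step T)\<^sup>2 / (8 * c) \<le> step T * \<epsilon> / 4"
  proof -
    have "step T * \<epsilon> * step T \<le> step T * \<epsilon> * (2 * c)"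
      using small eps ts(3) by (intro mult_left_mono) (auto simp: T_def)
    then show ?thesis using c_pos by (simp add: power2_eq_square field_simps)
  qed
  also have "weight T * ?v + step T * \<epsilon> / 4 + step T * \<epsilon> / 4 = weight T * (?v + step T / (2 * weight T) * \<epsilon>)"
    unfolding distrib_left[of "weight T" ?v] using A by simp
  finally have "weight T * F k j (t_pt T) \<le> weight T * (?v + step T / (2 * weight T) * \<epsilon>)" by simp
  then show ?thesis using A unfolding ustm_accept_def T_def[symmetric]
    by (simp add: mult_le_cancel_left)
qed

text \<open>Doubling the estimate long enough would bring the step down to \<open>2 * c\<close>,
  which is accepted. Hence the \<open>LEAST\<close> in the recursion denotes a real trial.\<close>

lemma some_trial_accepted:
  assumes S: "0 < lip (st k)" "0 \<le> weight (st k)"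
  shows "\<exists>j. acc k j"
proof (rule ccontr)
  assume "\<nexists>j. acc k j"
  then have rej: "\<not> acc k j" for j by blast
  \<comment> \<open>Chosen so that \<open>2 * c\<close> violates the root criterion, that is,
    \<open>L (2 c)^2 > A + 2 c\<close>.\<close>
  obtain j where j: "(2 * c + weight (st k)) / (4 * c\<^sup>2) / (lip (st k) / 2) < 2 ^ j"
    using real_arch_pow[of 2] by auto
  have "(2 * c + weight (st k)) / (4 * c\<^sup>2) < 2 ^ j * (lip (st k) / 2)"
    using j S by (simp only: pos_divide_less_eq half_gt_zero)
  then have big: "2 * c + weight (st k) < lip (tr k j) * (2 * c)\<^sup>2"
    unfolding ustm_trial_simps(1)[OF S refl] using c_pos by (simp add: field_simps)
  have "step (tr k j) \<le> 2 * c"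
  proof (rule ccontr)
    assume "\<not> step (tr k j) \<le> 2 * c"
    moreover note ts = ustm_trial_simps[OF S refl, of h Q "F k j" "G k j" j]
    ultimately have "lip (tr k j) * (2 * c)\<^sup>2 \<le> weight (st k) + 2 * c"
      using le_quadratic_root_iff[of "lip (tr k j)" "weight (st k)" "step (tr k j)" "2 * c"] S c_pos
      by simp
    then show False using big by simp
  qed
  then show False using small_step_accepted[OF S] rej by blast
qed

lemma st_Suc:
  assumes S: "0 < lip (st k)" "0 \<le> weight (st k)"
  obtains j where "st (Suc k) = tr k j" "acc k j" "\<forall>j'<j. \<not> acc k j'"
proof -
  define j where "j = (LEAST j. acc k j)"
  have "st (Suc k) = tr k j" by (simp add: ustm.simps(2) Let_def j_def)
  moreover have "acc k j" unfolding j_def using some_trial_accepted[OF S] by (rule LeastI_ex)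
  moreover have "\<forall>j'<j. \<not> acc k j'" unfolding j_def using not_less_Least by blast
  ultimately show ?thesis by (rule that)
qed

text \<open>
  If the last trial of an iteration is the first one, then the Lipschitz estimate was halved and the
  step grows at least by \<open>\<surd>2\<close>. Otherwise the estimate \<open>L/2\<close> was rejected, so its step exceeds \<open>2c\<close>,
  and doubling the estimate shrinks a step to between \<open>1/2\<close> (weight \<open>0\<close>) and \<open>1/\<surd>2\<close> (large weight).
\<close>

lemma step_bounds:
  assumes S: "0 < lip (st k)" "0 \<le> weight (st k)"
    and inv: "(k = 0 \<and> weight (st k) = 0 \<and> lip (st k) = L0) \<or>
      (c \<le> step (st k) \<and> lip (st k) * (step (st k))\<^sup>2 = weight (st k))"
    and j: "\<forall>j'<j. \<not> acc k j'"
  shows "c \<le> step (tr k j)" and "3 * c \<le> weight (st k) \<Longrightarrow> 13 / 10 * c \<le> step (tr k j)"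
proof -
  note ts = ustm_trial_simps[OF S refl, of h Q "F k j" "G k j" j]
  define L s A where "L = lip (tr k j)" and "s = step (tr k j)" and "A = weight (st k)"
  have s: "0 < L" "0 < s" "0 \<le> A" "L * s\<^sup>2 = A + s" using ts S by (auto simp: L_def s_def A_def)
  have "c \<le> s \<and> (3 * c \<le> A \<longrightarrow> 13 / 10 * c \<le> s)"
  proof (cases j)
    case 0
    then have L2: "L = lip (st k) / 2" using ts(1) by (simp add: L_def)
    from inv show ?thesis
    proof
      assume k: "k = 0 \<and> weight (st k) = 0 \<and> lip (st k) = L0"
      \<comment> \<open>With weight 0 the quadratic equation degenerates to
        \<open>s = 1 / L = 2 / L0\<close>, and the assumed upper bound on \<open>L0\<close> gives
        \<open>8 * c\<close>.\<close>
      then have "L0 / 2 * s\<^sup>2 = s" using L2 s(4) unfolding A_def by (metis add_0)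
      then have "s * (L0 / 2 * s) = s * 1" by (simp add: power2_eq_square algebra_simps)
      then have "L0 / 2 * s = 1" using s(2) by (metis less_irrefl mult_cancel_left)
      then have "s = 2 / L0" using L0 by (simp add: field_simps)
      moreover have "2 / L0 \<ge> 2 / (M\<^sup>2 / \<epsilon>)" using L0 eps M by (intro divide_left_mono) auto
      moreover have "2 / (M\<^sup>2 / \<epsilon>) = 8 * c" using eps M by (simp add: c_def)
      ultimately show ?thesis using c_pos by simp
    next
      assume k: "c \<le> step (st k) \<and> lip (st k) * (step (st k))\<^sup>2 = weight (st k)"
      have "L * (2 * (step (st k))\<^sup>2) = lip (st k) * (step (st k))\<^sup>2" unfolding L2 by simp
      then have "L * (2 * (step (st k))\<^sup>2) \<le> L * s\<^sup>2" using k s by (simp add: A_def)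
      then have "2 * (step (st k))\<^sup>2 \<le> s\<^sup>2" unfolding mult_le_cancel_left_pos[OF s(1)] .
      moreover have "c\<^sup>2 \<le> (step (st k))\<^sup>2" using k c_pos by (intro power_mono) auto
      \<comment> \<open>\<open>13 / 10\<close> is a rational number below the square root of
        2.\<close>
      ultimately have "(13 / 10 * c)\<^sup>2 \<le> s\<^sup>2"
        using zero_le_power2[of c] unfolding power_mult_distrib power2_eq_square[of "13 / 10"] by linarith
      then have "13 / 10 * c \<le> s" by (rule power2_le_imp_le) (use s in auto)
      then show ?thesis using c_pos by simp
    qed
  next
    case (Suc i)
    note ti = ustm_trial_simps[OF S refl, of h Q "F k i" "G k i" i]
    have "\<forall>j'<i. \<not> acc k j'" "\<not> acc k i" using j Suc by auto
    then have big: "2 * c < step (tr k i)" using small_step_accepted[OF S, of i] by fastforce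
    have "L = 2 * lip (tr k i)" using ts(1) ti(1) Suc by (simp add: L_def)
    moreover have "lip (tr k i) * (2 * c)\<^sup>2 \<le> A + 2 * c"
    proof (rule le_quadratic_root_iff[THEN iffD1])
      show "lip (tr k i) * (step (tr k i))\<^sup>2 = A + step (tr k i)"
        using ti(4,5) by (simp add: A_def)
    qed (use ti(2,3) s(3) big c_pos in auto)
    ultimately have Lc: "L * c\<^sup>2 \<le> (A + 2 * c) / 2" by (simp add: power2_eq_square)
    have root: "x \<le> s" if "0 < x" "L * x\<^sup>2 \<le> A + x" for x
      using le_quadratic_root_iff[OF s(1,3,2,4) that(1)] that(2) by blast
    have "c \<le> s" by (rule root) (use Lc s c_pos in auto)
    \<comment> \<open>At \<open>13 / 10 * c\<close> the root criterion follows from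
      \<open>0.39 c \<le> 0.155 A\<close>, which \<open>3 * c \<le> A\<close> implies.\<close>
    moreover have "13 / 10 * c \<le> s" if "3 * c \<le> A"
    proof (rule root)
      show "L * (13 / 10 * c)\<^sup>2 \<le> A + 13 / 10 * c"
        using Lc that c_pos by (simp add: power2_eq_square)
    qed (use c_pos in auto)
    ultimately show ?thesis by simp
  qed
  then show "c \<le> step (tr k j)" "3 * c \<le> weight (st k) \<Longrightarrow> 13 / 10 * c \<le> step (tr k j)"
    by (auto simp: s_def A_def)
qed

text \<open>The initial state is a case of its own because its \<open>step\<close> is a dummy; there
  the bound on \<open>L0\<close> replaces the information about the previous step.\<close>

lemma st_invariant:
  "0 < lip (st k) \<and> real k * c \<le> weight (st k) \<and>
   ((k = 0 \<and> weight (st k) = 0 \<and> lip (st k) = L0) \<or>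
      (c \<le> step (st k) \<and> lip (st k) * (step (st k))\<^sup>2 = weight (st k)))"
proof (induction k)
  case 0
  then show ?case using L0 by (simp add: ustm_init_def)
next
  case (Suc k)
  then have S: "0 < lip (st k)" "0 \<le> weight (st k)"
    using c_pos by (auto intro: order_trans[of 0 "real k * c"])
  obtain j where j: "st (Suc k) = tr k j" "\<forall>j'<j. \<not> acc k j'" using st_Suc[OF S] by metis
  note ts = ustm_trial_simps[OF S refl, of h Q "F k j" "G k j" j]
  have "c \<le> step (tr k j)" using step_bounds[OF S] Suc j by blast
  then show ?case unfolding j(1) using ts(2-5) Suc by (auto simp: algebra_simps)
qed

lemma lip_pos: "0 < lip (st k)"
  and weight_ge: "real k * c \<le> weight (st k)"
  and weight_nonneg: "0 \<le> weight (st k)"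
  using st_invariant[of k] c_pos by (auto intro: order_trans[of 0 "real k * c"])

lemma step_ge: "c \<le> step (st (Suc k))"
  using st_invariant[of "Suc k"] by auto

lemma weight_Suc: "weight (st (Suc k)) = weight (st k) + step (st (Suc k))"
  using st_Suc[OF lip_pos weight_nonneg, of k] ustm_trial_simps(4)[OF lip_pos weight_nonneg refl] by metis

lemma weight_eq_sum: "weight (st K) = (\<Sum>k=1..K. step (st k))"
  by (induction K) (simp_all add: weight_Suc ustm_init_def)

text \<open>Three iterations bring the weight to at least \<open>3 * c\<close>; each later one adds
  at least \<open>13 / 10 * c\<close>.\<close>

lemma weight_ge_late:
  assumes "18 \<le> K"
  shows "5 / 4 * real K * c \<le> weight (st K)"
proof -
  have "(13 * real K - 9) / 10 * c \<le> weight (st K)" if "3 \<le> K" for K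
    using that
  proof (induction K rule: nat_induct_at_least)
    case base
    then show ?case using weight_ge[of 3] by simp
  next
    case (Suc K)
    obtain j where j: "st (Suc K) = tr K j" "\<forall>j'<j. \<not> acc K j'"
      using st_Suc[OF lip_pos weight_nonneg] by metis
    have "3 * c \<le> real K * c" using Suc c_pos by simp
    then have "3 * c \<le> weight (st K)" using weight_ge[of K] by simp
    then have "13 / 10 * c \<le> step (tr K j)"
      using step_bounds(2)[OF lip_pos weight_nonneg _ j(2)] st_invariant[of K] by blast
    then show ?case using Suc weight_Suc[of K] unfolding j(1) by (simp add: field_simps)
  qed
  then have "(13 * real K - 9) / 10 * c \<le> weight (st K)" using assms by simp
  \<comment> \<open>Equality holds at \<open>K = 18\<close>, which explains the threshold.\<close>
  moreover have "5 / 4 * real K * c \<le> (13 * real K - 9) / 10 * c"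
    using assms c_pos by (intro mult_right_mono) auto
  ultimately show ?thesis by simp
qed

text \<open>The affine minorant of \<open>\<Phi>\<close> based at \<open>y_pt (st k)\<close>. The
  index \<open>k - 1\<close> appears because state \<open>k\<close> is the outcome of iteration
  \<open>k - 1\<close>, whose accepted trial produced the reply.\<close>

definition lower_model :: "nat \<Rightarrow> 'x \<Rightarrow> real" where
  "lower_model k t = F (k - 1) (trial (st k)) (y_pt (st k))
     + G (k - 1) (trial (st k)) (y_pt (st k)) \<bullet> (t - y_pt (st k))"

lemma model_Suc:
  "model (st (Suc k)) t = model (st k) t + step (st (Suc k)) * (lower_model (Suc k) t + h t)"
proof -
  obtain j where j: "st (Suc k) = tr k j" using st_Suc[OF lip_pos weight_nonneg] by metis
  note ts = ustm_trial_simps[OF lip_pos weight_nonneg j]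
  show ?thesis unfolding lower_model_def ts(8) ts(10) by simp
qed

lemma model_eq:
  "model (st K) t = (norm (t - t0))\<^sup>2 / 2 + (\<Sum>k=1..K. step (st k) * lower_model k t)
     + weight (st K) * h t"
proof (induction K)
  case 0
  then show ?case by (simp add: ustm_init_def)
next
  case (Suc K)
  then show ?case unfolding model_Suc weight_Suc by (simp add: algebra_simps)
qed

text \<open>The weighted minorants collapse into one affine function
  \<open>a + b \<bullet> t\<close>, so the model has the shape required by
  \<open>strongly_convex_arg_min\<close>.\<close>

lemma model_arg_min:
  assumes "u = arg_min_on (model (st K)) Q"
  shows "u \<in> Q" and "t \<in> Q \<Longrightarrow> model (st K) u + (norm (t - u))\<^sup>2 / 2 \<le> model (st K) t"
proof -
  define g where "g k = G (k - 1) (trial (st k)) (y_pt (st k))" for k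
  define a where "a = (\<Sum>k=1..K. step (st k) * (F (k - 1) (trial (st k)) (y_pt (st k)) - g k \<bullet> y_pt (st k)))"
  define b where "b = (\<Sum>k=1..K. step (st k) *\<^sub>R g k)"
  have "(\<Sum>k=1..K. step (st k) * lower_model k t) = a + b \<bullet> t" for t
    unfolding a_def b_def inner_sum_left lower_model_def g_def[symmetric] sum.distrib[symmetric]
    by (intro sum.cong) (simp_all add: inner_diff_right algebra_simps)
  then have m: "model (st K) t = (norm (t - t0))\<^sup>2 / 2 + a + b \<bullet> t + weight (st K) * h t" for t
    unfolding model_eq by simp
  have ne: "Q \<noteq> {}" using Q by auto
  show "u \<in> Q" "t \<in> Q \<Longrightarrow> model (st K) u + (norm (t - u))\<^sup>2 / 2 \<le> model (st K) t"
    unfolding assms using strongly_convex_arg_min[OF m weight_nonneg h Q(1) ne] by auto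
qed

lemma u_pt_st: "u_pt (st K) \<in> Q"
  and model_u_pt: "t \<in> Q \<Longrightarrow> model (st K) (u_pt (st K)) + (norm (t - u_pt (st K)))\<^sup>2 / 2 \<le> model (st K) t"
proof -
  have "u_pt (st K) \<in> Q \<and> (\<forall>t\<in>Q. model (st K) (u_pt (st K)) + (norm (t - u_pt (st K)))\<^sup>2 / 2 \<le> model (st K) t)"
  proof (cases K)
    \<comment> \<open>The initial model is half the squared distance from \<open>t0\<close>, which
      is also the initial \<open>u_pt\<close>; the growth bound is an equality.\<close>
    case 0
    then show ?thesis using Q by (simp add: ustm_init_def)
  next
    case (Suc k)
    obtain j where j: "st (Suc k) = tr k j" using st_Suc[OF lip_pos weight_nonneg] by metis
    have "u_pt (st K) = arg_min_on (model (st K)) Q"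
      unfolding Suc j by (rule ustm_trial_simps(9)[OF lip_pos weight_nonneg refl])
    then show ?thesis using model_arg_min[of _ K] by blast
  qed
  then show "u_pt (st K) \<in> Q"
    "t \<in> Q \<Longrightarrow> model (st K) (u_pt (st K)) + (norm (t - u_pt (st K)))\<^sup>2 / 2 \<le> model (st K) t" by auto
qed

lemma t_pt_st: "t_pt (st K) \<in> Q"
proof (induction K)
  case 0
  then show ?case using Q by (simp add: ustm_init_def)
next
  case (Suc k)
  obtain j where j: "st (Suc k) = tr k j" using st_Suc[OF lip_pos weight_nonneg] by metis
  note ts = ustm_trial_simps[OF lip_pos weight_nonneg j]
  have "convex Q" using h(1) by (simp add: convex_on_def)
  then show ?case
  proof (rule scaled_convex_combination_mem)
    show "u_pt (st (Suc k)) \<in> Q" "t_pt (st k) \<in> Q \<or> weight (st k) = 0"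
      using u_pt_st Suc by auto
    show "(step (st (Suc k)) + weight (st k)) *\<^sub>R t_pt (st (Suc k))
        = step (st (Suc k)) *\<^sub>R u_pt (st (Suc k)) + weight (st k) *\<^sub>R t_pt (st k)"
      using ts(4,7) by (simp only: add.commute)
  qed (use ts(3) weight_nonneg[of k] in auto)
qed

text \<open>
  The error of a step is bounded in two ways: through the acceptance test by
  \<open>3/4 s \<epsilon>\<close>, and through the bounded variation of the gradients by \<open>s \<epsilon> / 4 + M\<^sup>2 s\<^sup>2 / 2\<close>.
  The first bound alone is too weak when the steps are as short as \<open>c\<close>.
\<close>

lemma step_error:
  assumes "T = st (Suc k)"
  shows "weight T * \<Phi> (t_pt T) \<le> weight T * (lower_model (Suc k) (t_pt T)
      + lip T / 2 * (norm (t_pt T - y_pt T))\<^sup>2) + \<epsilon> * (step T - 5 / 8 * c)"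
proof -
  obtain j where j: "st (Suc k) = tr k j" "acc k j" "\<forall>j'<j. \<not> acc k j'"
    using st_Suc[OF lip_pos weight_nonneg] by metis
  have T: "T = tr k j" using assms j by simp
  note ts = ustm_trial_simps[OF lip_pos weight_nonneg T]
  let ?v = "F k j (y_pt T) + G k j (y_pt T) \<bullet> (t_pt T - y_pt T)
      + lip T / 2 * (norm (t_pt T - y_pt T))\<^sup>2"
  have lm: "lower_model (Suc k) (t_pt T) = F k j (y_pt T) + G k j (y_pt T) \<bullet> (t_pt T - y_pt T)"
    unfolding lower_model_def assms[symmetric] ts(10) by simp
  have A: "0 < weight T" using ts weight_nonneg[of k] by linarith
  have s: "c \<le> step T" using step_ge[of k] assms by simp
  have 1: "weight T * \<Phi> (t_pt T) \<le> weight T * ?v + step T * \<epsilon> / 4 + \<epsilon> * (step T)\<^sup>2 / (8 * c)"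
    using trial_error[OF lip_pos weight_nonneg j(3) T] .
  have "inexact_oracle_at \<Phi> M (step T * \<epsilon> / (4 * weight T)) (F k j (t_pt T)) (G k j (t_pt T)) (t_pt T)"
    using replies[OF j(3) T, of "t_pt T"] by simp
  \<comment> \<open>At its own base point the reply underestimates \<open>\<Phi>\<close> by at most
    the accuracy. Scaled, this is \<open>s \<epsilon> / 4\<close>, added to the
    \<open>s \<epsilon> / 2\<close> granted by the test.\<close>
  then have "\<Phi> (t_pt T) \<le> F k j (t_pt T) + G k j (t_pt T) \<bullet> (t_pt T - t_pt T)
      + M * norm (t_pt T - t_pt T) + step T * \<epsilon> / (4 * weight T)"
    unfolding inexact_oracle_at_def by blast
  also have "F k j (t_pt T) \<le> ?v + step T / (2 * weight T) * \<epsilon>"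
    using j(2) unfolding ustm_accept_def T[symmetric] .
  finally have "\<Phi> (t_pt T) \<le> ?v + step T / (2 * weight T) * \<epsilon> + step T * \<epsilon> / (4 * weight T)"
    by simp
  then have "weight T * \<Phi> (t_pt T) \<le> weight T * (?v + step T / (2 * weight T) * \<epsilon> + step T * \<epsilon> / (4 * weight T))"
    using A by simp
  also have "\<dots> = weight T * ?v + 3 / 4 * (step T * \<epsilon>)"
    unfolding distrib_left[of "weight T"] using A by simp
  finally have 2: "weight T * \<Phi> (t_pt T) \<le> weight T * ?v + 3 / 4 * (step T * \<epsilon>)" .
  show ?thesis
  proof (cases "step T \<le> 5 * c")
    case True
    \<comment> \<open>This product is the claim
      \<open>s / 4 + s^2 / (8 c) \<le> s - 5 / 8 * c\<close> multiplied by \<open>8 c\<close>.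
      Beyond \<open>5 * c\<close> the other bound is enough, since
      \<open>3 / 4 * s \<le> s - 5 / 8 * c\<close> from \<open>5 / 2 * c\<close> on.\<close>
    have "(step T - c) * (step T - 5 * c) \<le> 0" using True s by (simp add: mult_le_0_iff)
    then have "\<epsilon> * ((step T - c) * (step T - 5 * c)) \<le> 0" using eps by (simp add: mult_le_0_iff)
    then have "\<epsilon> * ((step T)\<^sup>2 - 6 * (c * step T) + 5 * c\<^sup>2) \<le> 0"
      by (simp add: power2_eq_square algebra_simps)
    then have "step T * \<epsilon> / 4 + \<epsilon> * (step T)\<^sup>2 / (8 * c) \<le> \<epsilon> * (step T - 5 / 8 * c)"
      using c_pos by (simp add: field_simps power2_eq_square)
    then show ?thesis using 1 unfolding lm by simp
  next
    case False
    then have "\<epsilon> * (3 / 4 * step T) \<le> \<epsilon> * (step T - 5 / 8 * c)"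
      using eps c_pos by (intro mult_left_mono) auto
    then show ?thesis using 2 unfolding lm by (simp add: algebra_simps)
  qed
qed

text \<open>The estimating sequence argument. At the new \<open>t_pt\<close>, convexity of
  \<open>h\<close> and affinity of the minorant split the value between the new \<open>u_pt\<close>
  and the old \<open>t_pt\<close>; the old part falls under the induction hypothesis, and the new
  part is what the model gains.\<close>

lemma certificate_at_u_pt:
  "weight (st K) * (\<Phi> (t_pt (st K)) + h (t_pt (st K)))
     \<le> model (st K) (u_pt (st K)) + \<epsilon> * (weight (st K) - 5 / 8 * (real K * c))"
proof (induction K)
  case 0
  then show ?case by (simp add: ustm_init_def)
next
  case (Suc k)
  define S T where "S = st k" and "T = st (Suc k)"
  obtain j where j: "st (Suc k) = tr k j" "\<forall>j'<j. \<not> acc k j'"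
    using st_Suc[OF lip_pos weight_nonneg] by metis
  note ts = ustm_trial_simps[OF lip_pos weight_nonneg trans[OF T_def j(1)]]
  have A: "0 < weight T" "0 \<le> weight S" using ts weight_nonneg[of k] by (auto simp: S_def)
  have conv: "weight T * h (t_pt T) \<le> step T * h (u_pt T) + weight S * h (t_pt S)"
  proof -
    have "t_pt T = (1 / weight T) *\<^sub>R (weight T *\<^sub>R t_pt T)" using A by simp
    also have "\<dots> = (1 - weight S / weight T) *\<^sub>R u_pt T + (weight S / weight T) *\<^sub>R t_pt S"
    proof -
      have "step T / weight T = 1 - weight S / weight T"
        using ts(4) A by (simp add: field_simps S_def)
      then show ?thesis unfolding ts(7) S_def[symmetric] by (simp add: scaleR_add_right)
    qed
    finally have "h (t_pt T) \<le> (1 - weight S / weight T) * h (u_pt T) + weight S / weight T * h (t_pt S)"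
      using convex_onD[OF h(1), of "weight S / weight T" "u_pt T" "t_pt S"]
        u_pt_st[of "Suc k"] t_pt_st[of k] A ts(3,4) by (simp add: S_def T_def)
    then have "weight T * h (t_pt T) \<le> weight T * ((1 - weight S / weight T) * h (u_pt T) + weight S / weight T * h (t_pt S))"
      using A by simp
    also have "\<dots> = (weight T - weight S) * h (u_pt T) + weight S * h (t_pt S)"
      using A(1) by (simp add: field_simps)
    finally show ?thesis using ts(4) by (simp add: S_def)
  qed
  let ?l = "lower_model (Suc k)"
  define v g y where "v = F k (trial T) (y_pt T)" and "g = G k (trial T) (y_pt T)" and "y = y_pt T"
  have l: "?l t = v + g \<bullet> (t - y)" for t
    unfolding lower_model_def v_def g_def y_def T_def by simp
  have "inexact_oracle_at \<Phi> M (step T * \<epsilon> / (4 * weight T)) v g y"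
    using replies[OF j(2), of T "y_pt T"] j(1) ts(10) by (simp add: v_def g_def y_def T_def)
  then have below: "?l t \<le> \<Phi> t" for t unfolding l inexact_oracle_at_def by blast
  have comb: "weight T * ?l (t_pt T) = step T * ?l (u_pt T) + weight S * ?l (t_pt S)"
  proof -
    have "weight T * ?l (t_pt T) = weight T * (v - g \<bullet> y) + g \<bullet> (weight T *\<^sub>R t_pt T)"
      unfolding l by (simp add: inner_diff_right algebra_simps)
    also have "weight T *\<^sub>R t_pt T = step T *\<^sub>R u_pt T + weight S *\<^sub>R t_pt S"
      using ts(7) by (simp add: S_def)
    also have "weight T * (v - g \<bullet> y) + g \<bullet> \<dots> = step T * ?l (u_pt T) + weight S * ?l (t_pt S)"
      unfolding S_def[symmetric] l ts(4)
      by (simp add: inner_diff_right inner_add_right algebra_simps)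
    finally show ?thesis .
  qed
  \<comment> \<open>The similar triangles: \<open>t_pt - y_pt\<close> is
    \<open>step / weight\<close> times the displacement of \<open>u_pt\<close>, and
    \<open>L s^2 = A\<close> cancels all factors.\<close>
  have dist: "weight T * (lip T / 2 * (norm (t_pt T - y_pt T))\<^sup>2) = (norm (u_pt T - u_pt S))\<^sup>2 / 2"
  proof -
    have "weight T *\<^sub>R (t_pt T - y_pt T) = step T *\<^sub>R (u_pt T - u_pt S)"
      unfolding scaleR_diff_right ts(6,7) S_def by simp
    then have "norm (weight T *\<^sub>R (t_pt T - y_pt T)) = norm (step T *\<^sub>R (u_pt T - u_pt S))" by simp
    then have "weight T * norm (t_pt T - y_pt T) = step T * norm (u_pt T - u_pt S)"
      using A ts(3) by simp
    then have "(weight T)\<^sup>2 * (norm (t_pt T - y_pt T))\<^sup>2 = (step T)\<^sup>2 * (norm (u_pt T - u_pt S))\<^sup>2"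
      by (metis power_mult_distrib)
    then have "weight T * (lip T * (step T)\<^sup>2) * (norm (t_pt T - y_pt T))\<^sup>2 = (step T)\<^sup>2 * (norm (u_pt T - u_pt S))\<^sup>2"
      unfolding ts(5) by (simp add: power2_eq_square)
    then have "(step T)\<^sup>2 * (weight T * lip T * (norm (t_pt T - y_pt T))\<^sup>2) = (step T)\<^sup>2 * (norm (u_pt T - u_pt S))\<^sup>2"
      by (simp add: algebra_simps)
    then show ?thesis using ts(3) by simp
  qed
  have "weight T * (\<Phi> (t_pt T) + h (t_pt T))
      \<le> weight T * (?l (t_pt T) + lip T / 2 * (norm (t_pt T - y_pt T))\<^sup>2) + \<epsilon> * (step T - 5 / 8 * c)
        + weight T * h (t_pt T)"
    using step_error[OF T_def] by (simp add: algebra_simps)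
  also have "\<dots> \<le> step T * (?l (u_pt T) + h (u_pt T)) + weight S * (?l (t_pt S) + h (t_pt S))
      + (norm (u_pt T - u_pt S))\<^sup>2 / 2 + \<epsilon> * (step T - 5 / 8 * c)"
    using conv comb dist by (simp add: algebra_simps)
  also have "weight S * (?l (t_pt S) + h (t_pt S)) \<le> weight S * (\<Phi> (t_pt S) + h (t_pt S))"
    using below A by (intro mult_left_mono) auto
  also have "\<dots> \<le> model S (u_pt S) + \<epsilon> * (weight S - 5 / 8 * (real k * c))"
    using Suc by (simp add: S_def)
  \<comment> \<open>Quadratic growth of the old model at its minimizer pays exactly for the
    displacement term.\<close>
  also have "model S (u_pt S) \<le> model S (u_pt T) - (norm (u_pt T - u_pt S))\<^sup>2 / 2"
    using model_u_pt[OF u_pt_st, of k "Suc k"] unfolding S_def T_def by linarith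
  finally have "weight T * (\<Phi> (t_pt T) + h (t_pt T)) \<le>
      model S (u_pt T) + step T * (?l (u_pt T) + h (u_pt T)) + \<epsilon> * (weight S + step T - 5 / 8 * (real (Suc k) * c))"
    by (simp add: algebra_simps add_divide_distrib)
  then show ?case using ts(4) model_Suc[of k "u_pt T"] unfolding S_def T_def by simp
qed

text \<open>Since \<open>u_pt\<close> minimizes the model, it may be replaced by any comparison
  point; leaving \<open>t\<close> free is what allows a different choice for each congestion
  model.\<close>

theorem certificate:
  assumes "t \<in> Q"
  shows "weight (st K) * (\<Phi> (t_pt (st K)) + h (t_pt (st K)))
     \<le> (norm (t - t0))\<^sup>2 / 2 + (\<Sum>k=1..K. step (st k) * lower_model k t) + weight (st K) * h t
       + \<epsilon> * (weight (st K) - 5 / 8 * (real K * c))"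
proof -
  have "model (st K) (u_pt (st K)) \<le> model (st K) t"
    using model_u_pt[OF assms, of K] by (smt (verit) zero_le_power2 divide_nonneg_pos)
  then show ?thesis using certificate_at_u_pt[of K] unfolding model_eq by simp
qed

lemma st_Suc_trial:
  assumes "T = st (Suc k)"
  obtains j where "T = tr k j" "trial T = j" "\<forall>j'<j. \<not> acc k j'"
proof -
  obtain j where j: "st (Suc k) = tr k j" "\<forall>j'<j. \<not> acc k j'"
    using st_Suc[OF lip_pos weight_nonneg] by metis
  moreover have "trial (tr k j) = j" by (rule ustm_trial_simps(10)[OF lip_pos weight_nonneg refl])
  ultimately show ?thesis using that assms by metis
qed

end

section \<open>Entropy inequalities\<close>

text \<open>The function \<open>a ln (a / b)\<close> is convex and homogeneous of degree one, so it
  lies above its tangent plane at \<open>(x, y)\<close>. All entropy estimates reduce to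
  this.\<close>

lemma mult_ln_divide_tangent:
  fixes a b x y :: real
  assumes "0 \<le> a" "0 \<le> b" "b = 0 \<Longrightarrow> a = 0" "0 < x" "0 < y"
  shows "a * ln (x / y) + a - b * (x / y) \<le> a * ln (a / b)"
proof (cases "a = 0")
  case True
  then show ?thesis using assms by simp
next
  case False
  then have ab: "0 < a" "0 < b" using assms by (auto simp: less_le)
  have "ln ((x / y) / (a / b)) \<le> (x / y) / (a / b) - 1"
    using ab assms by (intro ln_le_minus_one) simp
  then have "ln (x / y) - ln (a / b) \<le> (x / y) / (a / b) - 1"
    using ab assms by (simp only: ln_divide_pos[OF divide_pos_pos divide_pos_pos])
  then have "a * (ln (x / y) - ln (a / b)) \<le> a * ((x / y) / (a / b) - 1)"
    using ab by (simp add: mult_left_mono)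
  also have "\<dots> = b * (x / y) - a" using ab by (simp add: field_simps)
  finally show ?thesis by (simp add: algebra_simps)
qed

text \<open>Sum the tangent bounds at the point \<open>(x, y)\<close> of the weighted totals: the
  two linear terms cancel.\<close>

lemma log_sum_inequality:
  fixes c a b :: "'k \<Rightarrow> real"
  assumes fin: "finite K"
    and nonneg: "\<And>k. k \<in> K \<Longrightarrow> 0 \<le> c k \<and> 0 \<le> a k \<and> 0 \<le> b k \<and> (b k = 0 \<longrightarrow> a k = 0)"
  defines "x \<equiv> (\<Sum>k\<in>K. c k * a k)" and "y \<equiv> (\<Sum>k\<in>K. c k * b k)"
  shows "x * ln (x / y) \<le> (\<Sum>k\<in>K. c k * (a k * ln (a k / b k)))"
proof (cases "x = 0")
  case True
  then have "c k * a k = 0" if "k \<in> K" for k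
    unfolding x_def using sum_nonneg_eq_0_iff[OF fin, of "\<lambda>k. c k * a k"] nonneg that by auto
  then have "(\<Sum>k\<in>K. c k * (a k * ln (a k / b k))) = 0"
    by (intro sum.neutral) (metis mult.assoc mult_zero_left)
  then show ?thesis using True by simp
next
  case False
  have "0 \<le> x" unfolding x_def using nonneg by (intro sum_nonneg) auto
  then have x: "0 < x" using False by simp
  have "y \<noteq> 0"
  proof
    assume "y = 0"
    then have "c k * b k = 0" if "k \<in> K" for k
      unfolding y_def using sum_nonneg_eq_0_iff[OF fin, of "\<lambda>k. c k * b k"] nonneg that by auto
    then have "c k * a k = 0" if "k \<in> K" for k using nonneg that by (metis mult_eq_0_iff)
    then have "x = 0" unfolding x_def by (intro sum.neutral) blast
    then show False using False by simp
  qed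
  moreover have "0 \<le> y" unfolding y_def using nonneg by (intro sum_nonneg) auto
  ultimately have y: "0 < y" by simp
  have "x * ln (x / y) = x * ln (x / y) + x - y * (x / y)" using y by simp
  also have "\<dots> = (\<Sum>k\<in>K. c k * (a k * ln (x / y) + a k - b k * (x / y)))"
    unfolding distrib_left right_diff_distrib sum.distrib sum_subtractf mult.assoc[symmetric]
      sum_distrib_right[symmetric] x_def[symmetric] y_def[symmetric] by simp
  also have "\<dots> \<le> (\<Sum>k\<in>K. c k * (a k * ln (a k / b k)))"
    using nonneg x y by (intro sum_mono mult_left_mono mult_ln_divide_tangent) auto
  finally show ?thesis .
qed

lemma mult_ln_ge:
  fixes x :: real
  assumes "0 \<le> x"
  shows "- 1 \<le> x * ln x"
  using mult_ln_divide_tangent[OF assms, of 1 1 1] assms by simp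

lemma gibbs_variational:
  fixes d T \<beta> :: "'m::finite \<Rightarrow> real"
  assumes \<alpha>: "0 < \<alpha>" and d: "\<And>m. 0 \<le> d m"
  defines "w \<equiv> \<lambda>m. exp (- \<alpha> * T m - \<beta> m)"
  shows "(\<Sum>m\<in>UNIV. d m) * (- (1 / \<alpha>) * ln (\<Sum>m\<in>UNIV. w m))
      \<le> (\<Sum>m\<in>UNIV. d m * T m) + (\<Sum>m\<in>UNIV. 1 / \<alpha> * d m * (ln (d m / (\<Sum>m\<in>UNIV. d m)) + \<beta> m))"
    and "(\<And>m. d m = D * (w m / (\<Sum>m\<in>UNIV. w m))) \<Longrightarrow> D * (- (1 / \<alpha>) * ln (\<Sum>m\<in>UNIV. w m))
      = (\<Sum>m\<in>UNIV. d m * T m) + (\<Sum>m\<in>UNIV. 1 / \<alpha> * d m * (ln (d m / (\<Sum>m\<in>UNIV. d m)) + \<beta> m))"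
proof -
  let ?d = "\<Sum>m\<in>UNIV. d m" and ?w = "\<Sum>m\<in>UNIV. w m"
  have w: "0 < w m" for m by (simp add: w_def)
  have W: "0 < ?w" using w by (intro sum_pos) auto
  have zero: "d m = 0" if "?d = 0" for m
    using that d by (simp add: sum_nonneg_eq_0_iff)
  \<comment> \<open>The gap is \<open>1 / \<alpha>\<close> times the relative entropy of
    \<open>d\<close> with respect to the logit split of the same total; it is nonnegative, and zero
    when \<open>d\<close> is that split.\<close>
  have split: "(\<Sum>m\<in>UNIV. d m * T m) + (\<Sum>m\<in>UNIV. 1 / \<alpha> * d m * (ln (d m / ?d) + \<beta> m))
      - ?d * (- (1 / \<alpha>) * ln ?w) = 1 / \<alpha> * (\<Sum>m\<in>UNIV. d m * ln (d m / ?d) - d m * ln (w m / ?w))"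
  proof -
    have "d m * T m + 1 / \<alpha> * d m * (ln (d m / ?d) + \<beta> m) - d m * (- (1 / \<alpha>) * ln ?w)
        = 1 / \<alpha> * (d m * ln (d m / ?d) - d m * ln (w m / ?w))" for m
    proof -
      have "ln (w m / ?w) = - \<alpha> * T m - \<beta> m - ln ?w"
        using w[of m] W by (simp add: ln_div) (simp add: w_def)
      then show ?thesis using \<alpha> by (simp only:) (simp add: field_simps)
    qed
    then show ?thesis
      by (simp only: sum_distrib_right sum_distrib_left sum.distrib[symmetric] sum_subtractf[symmetric])
  qed
  have "(\<Sum>m\<in>UNIV. d m * ln (w m / ?w) + d m - ?d * (w m / ?w)) \<le> (\<Sum>m\<in>UNIV. d m * ln (d m / ?d))"
    using d w W zero by (intro sum_mono mult_ln_divide_tangent) (auto intro: sum_nonneg)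
  moreover have "(\<Sum>m\<in>UNIV. ?d * (w m / ?w)) = ?d"
    unfolding sum_distrib_left[symmetric] sum_divide_distrib[symmetric] using W by simp
  ultimately have "0 \<le> (\<Sum>m\<in>UNIV. d m * ln (d m / ?d) - d m * ln (w m / ?w))"
    by (simp add: sum.distrib sum_subtractf)
  then have "0 \<le> 1 / \<alpha> * (\<Sum>m\<in>UNIV. d m * ln (d m / ?d) - d m * ln (w m / ?w))" using \<alpha> by simp
  then show "?d * (- (1 / \<alpha>) * ln ?w)
      \<le> (\<Sum>m\<in>UNIV. d m * T m) + (\<Sum>m\<in>UNIV. 1 / \<alpha> * d m * (ln (d m / ?d) + \<beta> m))"
    using split by linarith
  assume D: "\<And>m. d m = D * (w m / ?w)"
  have dD: "?d = D" unfolding D sum_distrib_left[symmetric] sum_divide_distrib[symmetric] using W by simp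
  have e: "d m * ln (d m / D) = d m * ln (w m / ?w)" for m
    unfolding D by (cases "D = 0") auto
  have "(\<Sum>m\<in>UNIV. d m * ln (d m / ?d) - d m * ln (w m / ?w)) = 0"
    unfolding dD by (simp only: e diff_self sum.neutral_const)
  then have "(\<Sum>m\<in>UNIV. d m * T m) + (\<Sum>m\<in>UNIV. 1 / \<alpha> * d m * (ln (d m / ?d) + \<beta> m))
      - ?d * (- (1 / \<alpha>) * ln ?w) = 0" using split by (metis mult_zero_right)
  then show "D * (- (1 / \<alpha>) * ln ?w)
      = (\<Sum>m\<in>UNIV. d m * T m) + (\<Sum>m\<in>UNIV. 1 / \<alpha> * d m * (ln (d m / ?d) + \<beta> m))"
    unfolding dD by simp
qed

section \<open>Functions with subgradients\<close>

lemma subgradient_convex_on: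
  fixes g :: "'x::real_inner \<Rightarrow> real"
  assumes "convex S" and sub: "\<And>x y. x \<in> S \<Longrightarrow> y \<in> S \<Longrightarrow> g x + w x \<bullet> (y - x) \<le> g y"
  shows "convex_on S g"
proof (rule convex_onI)
  fix t :: real and x y
  assume t: "0 < t" "t < 1" and xy: "x \<in> S" "y \<in> S"
  define z where "z = (1 - t) *\<^sub>R x + t *\<^sub>R y"
  have z: "z \<in> S" unfolding z_def using assms(1) xy t by (intro convexD) auto
  have "(1 - t) * (g z + w z \<bullet> (x - z)) + t * (g z + w z \<bullet> (y - z)) \<le> (1 - t) * g x + t * g y"
    using sub[OF z] xy t by (intro add_mono mult_left_mono) auto
  moreover have "(1 - t) * (w z \<bullet> (x - z)) + t * (w z \<bullet> (y - z)) = w z \<bullet> (((1 - t) *\<^sub>R x + t *\<^sub>R y) - z)"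
    by (simp add: inner_diff_right inner_add_right algebra_simps)
  ultimately show "g ((1 - t) *\<^sub>R x + t *\<^sub>R y) \<le> (1 - t) * g x + t * g y"
    unfolding z_def by (simp add: algebra_simps)
qed (rule assms)

text \<open>Near \<open>x\<close> the value \<open>g y\<close> is squeezed between the support line
  at \<open>x\<close> and the reversed one at \<open>y\<close>; the latter converges because
  \<open>w\<close> does.\<close>

lemma continuous_subgradient_continuous_on:
  fixes g :: "'x::real_inner \<Rightarrow> real"
  assumes sub: "\<And>x y. x \<in> S \<Longrightarrow> y \<in> S \<Longrightarrow> g x + w x \<bullet> (y - x) \<le> g y" and w: "continuous_on S w"
  shows "continuous_on S g"
  unfolding continuous_on_def
proof
  fix x assume x: "x \<in> S"
  have lim: "((\<lambda>y. g x + v y \<bullet> (y - x)) \<longlongrightarrow> g x) (at x within S)" if "(v \<longlongrightarrow> v x) (at x within S)" for v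
  proof -
    have "((\<lambda>y. g x + v y \<bullet> (y - x)) \<longlongrightarrow> g x + v x \<bullet> (x - x)) (at x within S)"
      by (intro tendsto_intros that)
    then show ?thesis by simp
  qed
  show "(g \<longlongrightarrow> g x) (at x within S)"
  proof (rule tendsto_sandwich)
    show "\<forall>\<^sub>F y in at x within S. g x + w x \<bullet> (y - x) \<le> g y"
      using sub[OF x] by (auto simp: eventually_at_filter)
    show "\<forall>\<^sub>F y in at x within S. g y \<le> g x + w y \<bullet> (y - x)"
      using sub[OF _ x] by (auto simp: eventually_at_filter inner_diff_right algebra_simps)
    show "((\<lambda>y. g x + w x \<bullet> (y - x)) \<longlongrightarrow> g x) (at x within S)"
      using lim[of "\<lambda>_. w x"] by simp
    show "((\<lambda>y. g x + w y \<bullet> (y - x)) \<longlongrightarrow> g x) (at x within S)"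
      using lim[of w] w x by (simp add: continuous_on_def)
  qed
qed

section \<open>Link performance functions\<close>

locale traffic =
  fixes I :: "('v, 'e::finite, 'r::finite, 'a::finite, 'm::finite) traffic_problem"
  assumes wp: "well_posed I"
begin

lemma tbar_pos: "0 < tbar I $ e" and fbar_pos: "0 < fbar I $ e" and alpha_pos: "0 < alpha I a"
  and gamma_pos: "0 < gamma I r" and rho_pos: "0 < rho I" and mu_pos: "0 < mu I"
  and total_demand_pos: "0 < total_demand I"
  using wp unfolding well_posed_def by auto

lemma link_time_mono:
  assumes "0 \<le> y" "y \<le> z"
  shows "link_time I e y \<le> link_time I e z"
  unfolding link_time_def using assms tbar_pos[of e] fbar_pos[of e] rho_pos mu_pos
  by (auto intro!: mult_left_mono powr_mono2 divide_right_mono)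

lemma link_time_continuous_on: "continuous_on {0..} (link_time I e)"
proof -
  have "continuous_on {0..} (\<lambda>z. (z / fbar I $ e) powr (1 / mu I))"
    using tbar_pos[of e] fbar_pos[of e] rho_pos mu_pos by (intro continuous_on_powr' continuous_intros) auto
  then show ?thesis unfolding link_time_def[abs_def]
    by (intro continuous_on_mult continuous_on_add continuous_on_const)
qed

lemma sigma_zero: "sigma I e 0 = 0"
  by (simp add: sigma_def split: congestion_model.split)

section \<open>Beckmann links: cost, inverse of the travel time, conjugate\<close>

context
  assumes beckmann: "congestion I = Beckmann"
begin

text \<open>\<open>link_time\<close> is nondecreasing and is integrated to give
  \<open>sigma\<close>, so between \<open>y\<close> and \<open>z\<close> it stays on one side of its
  value at \<open>y\<close>.\<close>

lemma sigma_subgradient: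
  assumes "0 \<le> y" "0 \<le> z"
  shows "sigma I e y + link_time I e y * (z - y) \<le> sigma I e z"
proof -
  have int: "link_time I e integrable_on {x..y}" if "0 \<le> x" for x y
    using that by (intro integrable_continuous_real continuous_on_subset[OF link_time_continuous_on]) auto
  have combine: "sigma I e y + integral {y..z} (link_time I e) = sigma I e z" if "0 \<le> y" "y \<le> z" for y z
    unfolding sigma_def beckmann using that int[of 0 z]
    by (simp add: Henstock_Kurzweil_Integration.integral_combine)
  show ?thesis
  proof (cases "y \<le> z")
    case True
    have "integral {y..z} (\<lambda>_. link_time I e y) \<le> integral {y..z} (link_time I e)"
      using assms int by (intro integral_le link_time_mono) auto
    then show ?thesis using combine[OF assms(1) True] True by (simp add: mult.commute)
  next
    case False
    have "integral {z..y} (link_time I e) \<le> integral {z..y} (\<lambda>_. link_time I e y)"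
      using assms int by (intro integral_le link_time_mono) auto
    then show ?thesis using combine[OF assms(2), of y] False by (simp add: algebra_simps)
  qed
qed

lemma sigma_conj_link_time:
  assumes "0 \<le> z"
  shows "sigma_conj I e (link_time I e z) = link_time I e z * z - sigma I e z"
  unfolding sigma_conj_def
proof (rule cSup_eq_maximum)
  show "link_time I e z * z - sigma I e z \<in> (\<lambda>y. link_time I e z * y - sigma I e y) ` {0..}"
    using assms by auto
  fix x assume "x \<in> (\<lambda>y. link_time I e z * y - sigma I e y) ` {0..}"
  then obtain y where y: "0 \<le> y" "x = link_time I e z * y - sigma I e y" by auto
  then show "x \<le> link_time I e z * z - sigma I e z"
    using sigma_subgradient[OF assms y(1), of e] y(2) by (simp add: algebra_simps)
qed

text \<open>The inverse of \<open>link_time I e\<close> on times at least \<open>tbar I $ e\<close>,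
  and therefore a subgradient of the conjugate.\<close>

definition demand_at :: "'e \<Rightarrow> real \<Rightarrow> real" where
  "demand_at e \<theta> = fbar I $ e * ((\<theta> / tbar I $ e - 1) / rho I) powr mu I"

lemma demand_at:
  assumes "tbar I $ e \<le> \<theta>"
  shows "0 \<le> demand_at e \<theta>" and "link_time I e (demand_at e \<theta>) = \<theta>"
proof -
  show "0 \<le> demand_at e \<theta>" using tbar_pos[of e] fbar_pos[of e] rho_pos mu_pos by (simp add: demand_at_def less_imp_le)
  define q where "q = (\<theta> / tbar I $ e - 1) / rho I"
  have x: "0 \<le> q" unfolding q_def using assms tbar_pos[of e] fbar_pos[of e] rho_pos mu_pos by (simp add: field_simps)
  have "(demand_at e \<theta> / fbar I $ e) powr (1 / mu I) = q"
    unfolding demand_at_def q_def[symmetric] using tbar_pos[of e] fbar_pos[of e] rho_pos mu_pos x by (simp add: powr_powr)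
  then show "link_time I e (demand_at e \<theta>) = \<theta>"
    unfolding link_time_def q_def using tbar_pos[of e] rho_pos by (simp add: field_simps)
qed

lemma demand_at_continuous_on: "continuous_on {tbar I $ e..} (demand_at e)"
  unfolding demand_at_def[abs_def] using tbar_pos[of e] fbar_pos[of e] rho_pos mu_pos
  by (intro continuous_intros continuous_on_powr') (auto simp: field_simps)

text \<open>The supremum in \<open>sigma_conj\<close> is attained at
  \<open>demand_at e \<theta>\<close>, where its value is known; the subgradient inequality of
  \<open>sigma\<close> does the rest.\<close>

lemma fenchel_young:
  assumes "tbar I $ e \<le> \<theta>" "0 \<le> z"
  shows "\<theta> * z - sigma I e z \<le> sigma_conj I e \<theta>"
  using sigma_subgradient[OF demand_at(1)[OF assms(1)] assms(2), of e]
    sigma_conj_link_time[OF demand_at(1)[OF assms(1)], of e] demand_at(2)[OF assms(1)]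
  by (simp add: algebra_simps)

lemma sigma_conj_subgradient:
  assumes "tbar I $ e \<le> \<theta>" "tbar I $ e \<le> \<theta>'"
  shows "sigma_conj I e \<theta> + demand_at e \<theta> * (\<theta>' - \<theta>) \<le> sigma_conj I e \<theta>'"
  using fenchel_young[OF assms(2) demand_at(1)[OF assms(1)]]
    sigma_conj_link_time[OF demand_at(1)[OF assms(1)], of e] demand_at(2)[OF assms(1)]
  by (simp add: algebra_simps)

end

text \<open>A continuous choice of subgradients handles both models at once and yields convexity as
  well as continuity of \<open>h_fun\<close> on its domain.\<close>

lemma h_fun_subgradient:
  obtains w where "continuous_on (dom_h I) w"
    "\<And>x y. x \<in> dom_h I \<Longrightarrow> y \<in> dom_h I \<Longrightarrow> h_fun I x + w x \<bullet> (y - x) \<le> h_fun I y"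
proof (cases "congestion I")
  case Beckmann
  let ?w = "\<lambda>t. \<chi> e. demand_at e (t $ e)"
  show ?thesis
  proof
    show "continuous_on (dom_h I) ?w"
    proof (intro continuous_on_vec_lambda)
      fix e
      show "continuous_on (dom_h I) (\<lambda>t. demand_at e (t $ e))"
        by (rule continuous_on_compose2[OF demand_at_continuous_on[OF Beckmann]])
          (auto simp: dom_h_def intro!: continuous_intros)
    qed
    show "h_fun I x + ?w x \<bullet> (y - x) \<le> h_fun I y" if "x \<in> dom_h I" "y \<in> dom_h I" for x y
      using that unfolding h_fun_def Beckmann inner_vec_def
      by (simp add: sum.distrib[symmetric] dom_h_def sum_mono sigma_conj_subgradient[OF Beckmann])
  qed
next
  case Stable_Dynamics
  show ?thesis
    by (rule that[of "\<lambda>_. fbar I"])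
      (auto simp: h_fun_def Stable_Dynamics inner_diff_left inner_diff_right inner_commute)
qed

lemma dom_h_closed: "closed (dom_h I)"
proof -
  have "dom_h I = (\<Inter>e. {t. tbar I $ e \<le> t $ e})" by (auto simp: dom_h_def)
  then show ?thesis by (auto intro!: closed_INT closed_Collect_le continuous_intros)
qed

lemma dom_h_convex: "convex (dom_h I)"
proof -
  have "dom_h I = (\<Inter>e. {t. tbar I $ e \<le> t $ e})" by (auto simp: dom_h_def)
  moreover have "convex {t::real^'e. tbar I $ e \<le> t $ e}" for e
    using convex_halfspace_ge[of "tbar I $ e" "axis e (1::real)"] by (simp add: inner_axis')
  ultimately show ?thesis by (auto intro: convex_INT)
qed

lemma tbar_dom_h: "tbar I \<in> dom_h I"
  by (simp add: dom_h_def)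

lemma h_fun_convex_on: "convex_on (dom_h I) (h_fun I)"
  by (rule h_fun_subgradient) (rule subgradient_convex_on[OF dom_h_convex])

lemma h_fun_continuous_on: "continuous_on (dom_h I) (h_fun I)"
  by (rule h_fun_subgradient) (rule continuous_subgradient_continuous_on)

lemma h_fun_nonneg:
  assumes "t \<in> dom_h I"
  shows "0 \<le> h_fun I t"
proof (cases "congestion I")
  case Beckmann
  have "0 \<le> sigma_conj I e (t $ e)" for e
    using fenchel_young[OF Beckmann, of e "t $ e" 0] assms sigma_zero[of e] by (simp add: dom_h_def)
  then show ?thesis by (simp add: h_fun_def Beckmann sum_nonneg)
next
  case Stable_Dynamics
  have "0 \<le> (t $ e - tbar I $ e) * fbar I $ e" for e
    using assms tbar_pos[of e] fbar_pos[of e] rho_pos mu_pos by (simp add: dom_h_def)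
  then show ?thesis by (simp add: h_fun_def Stable_Dynamics inner_vec_def sum_nonneg)
qed

section \<open>Paths and flows\<close>

text \<open>One fixed order of summation for scalars and link vectors alike, so that costs,
  entropies and flows can be compared term by term.\<close>

definition od_sum :: "('v \<Rightarrow> 'v \<Rightarrow> 'r \<Rightarrow> 'a \<Rightarrow> 'b::comm_monoid_add) \<Rightarrow> 'b" where
  "od_sum X = (\<Sum>i\<in>origins I. \<Sum>j\<in>dests I. \<Sum>r\<in>UNIV. \<Sum>a\<in>UNIV. X i j r a)"

lemma od_sum_cong:
  assumes "\<And>i j r a. i \<in> origins I \<Longrightarrow> j \<in> dests I \<Longrightarrow> X i j r a = Y i j r a"
  shows "od_sum X = od_sum Y"
  unfolding od_sum_def using assms by (intro sum.cong refl) auto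

lemma od_sum_mono:
  fixes X :: "'v \<Rightarrow> 'v \<Rightarrow> 'r \<Rightarrow> 'a \<Rightarrow> real"
  assumes "\<And>i j r a. i \<in> origins I \<Longrightarrow> j \<in> dests I \<Longrightarrow> X i j r a \<le> Y i j r a"
  shows "od_sum X \<le> od_sum Y"
  unfolding od_sum_def using assms by (intro sum_mono) auto

lemma od_sum_add: "od_sum (\<lambda>i j r a. X i j r a + Y i j r a) = od_sum X + od_sum Y"
  by (simp add: od_sum_def sum.distrib)

lemma od_sum_left:
  fixes X :: "'v \<Rightarrow> 'v \<Rightarrow> 'r \<Rightarrow> 'a \<Rightarrow> real"
  shows "c * od_sum X = od_sum (\<lambda>i j r a. c * X i j r a)"
  by (simp add: od_sum_def sum_distrib_left)

lemma od_sum_sum: "od_sum (\<lambda>i j r a. \<Sum>k\<in>K. X k i j r a) = (\<Sum>k\<in>K. od_sum (X k))"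
  unfolding od_sum_def by (simp only: sum.swap[of _ K])

lemma od_sum_inner: "v \<bullet> od_sum X = od_sum (\<lambda>i j r a. v \<bullet> X i j r a)"
  by (simp add: od_sum_def inner_sum_right)

lemma od_sum_component: "od_sum X $ e = od_sum (\<lambda>i j r a. X i j r a $ e)"
  by (simp add: od_sum_def)

lemma norm_od_sum:
  fixes X :: "'v \<Rightarrow> 'v \<Rightarrow> 'r \<Rightarrow> 'a \<Rightarrow> 'b::real_normed_vector"
  shows "norm (od_sum X) \<le> od_sum (\<lambda>i j r a. norm (X i j r a))"
  unfolding od_sum_def
  by (intro order_trans[OF norm_sum] sum_mono order_refl)

lemma fin_digraph_network: "fin_digraph (network I)"
  using wp by (simp add: well_posed_def)

lemma finite_dests: "finite (dests I)"
proof -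
  have "finite (verts (network I))" using fin_digraph.finite_verts[OF fin_digraph_network] .
  then show ?thesis using wp unfolding well_posed_def by (auto intro: finite_subset)
qed

lemma
  assumes "i \<in> origins I" "j \<in> dests I"
  shows finite_paths: "finite (paths I i j m)" and paths_nonempty: "paths I i j m \<noteq> {}"
    and length_paths: "p \<in> paths I i j m \<Longrightarrow> length p \<le> max_links I"
proof -
  have sub: "paths I i j m \<noteq> {}" "paths I i j m \<subseteq> {p. pre_digraph.apath (network I) i p j}"
    using wp assms unfolding well_posed_def by auto
  show "paths I i j m \<noteq> {}" by (rule sub)
  show "finite (paths I i j m)"
    by (rule finite_subset[OF sub(2) fin_digraph.apaths_finite[OF fin_digraph_network]])
  \<comment> \<open>\<open>Max\<close> is meaningful on finite sets only; the lengths are an image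
    of the finite set of all simple paths with their end points.\<close>
  have "{length p |u p v. pre_digraph.apath (network I) u p v}
      = (\<lambda>(u, p, v). length p) ` {(u, p, v). pre_digraph.apath (network I) u p v}" by force
  then have "finite {length p |u p v. pre_digraph.apath (network I) u p v}"
    using fin_digraph.apaths_finite_triple[OF fin_digraph_network] by simp
  then show "length p \<le> max_links I" if "p \<in> paths I i j m"
    unfolding max_links_def using that sub(2) by (intro Max_ge) auto
qed

definition path_vec :: "'e list \<Rightarrow> real ^ 'e" where
  "path_vec p = (\<chi> e. if e \<in> set p then 1 else 0)"

text \<open>The squared norm of an incidence vector counts the distinct links of the path. This is
  the source of the factor \<open>sqrt (max_links I)\<close>.\<close>

lemma norm_path_vec:
  assumes "i \<in> origins I" "j \<in> dests I" "p \<in> paths I i j m"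
  shows "norm (path_vec p) \<le> sqrt (real (max_links I))"
proof -
  have "(norm (path_vec p))\<^sup>2 = (\<Sum>e\<in>UNIV. if e \<in> set p then 1 else 0)"
    unfolding power2_norm_eq_inner inner_vec_def path_vec_def by (intro sum.cong) auto
  also have "\<dots> = real (card (set p))" by (simp add: sum.If_cases)
  also have "\<dots> \<le> real (max_links I)"
    using length_paths[OF assms] card_length[of p] by simp
  finally show ?thesis by (simp add: real_le_rsqrt)
qed

definition mode_cost_vec :: "'m \<Rightarrow> real ^ 'e" where
  "mode_cost_vec m = (\<chi> e. mode_cost I e m)"

lemma path_cost_inner: "path_cost I t m p = (t + mode_cost_vec m) \<bullet> path_vec p"
proof -
  have "(t + mode_cost_vec m) \<bullet> path_vec p = (\<Sum>e\<in>UNIV. if e \<in> set p then t $ e + mode_cost I e m else 0)"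
    unfolding inner_vec_def path_vec_def mode_cost_vec_def by (intro sum.cong) auto
  then show ?thesis by (simp add: path_cost_def sum.If_cases)
qed

lemma mode_time_le:
  assumes "i \<in> origins I" "j \<in> dests I" "p \<in> paths I i j m"
  shows "mode_time I t i j m \<le> path_cost I t m p"
  unfolding mode_time_def using finite_paths[OF assms(1,2)] assms(3) by (intro Min_le) auto

lemma shortest_path_exists:
  assumes "i \<in> origins I" "j \<in> dests I"
  obtains p where "p \<in> paths I i j m" "path_cost I t m p = mode_time I t i j m"
proof -
  have "mode_time I t i j m \<in> path_cost I t m ` paths I i j m"
    unfolding mode_time_def using finite_paths[OF assms] paths_nonempty[OF assms] by (intro Min_in) auto
  then show ?thesis using that by auto
qed

lemma link_flows_od_sum:
  "link_flows I x m = od_sum (\<lambda>i j r a. \<Sum>p\<in>paths I i j m. x i j r a m p *\<^sub>R path_vec p)"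
proof (rule vec_eq_iff[THEN iffD2], rule allI)
  fix e
  let ?X = "\<lambda>i j r a. \<Sum>p\<in>{p \<in> paths I i j m. e \<in> set p}. x i j r a m p"
  have "link_flows I x m $ e = (\<Sum>r\<in>UNIV. \<Sum>a\<in>UNIV. \<Sum>i\<in>origins I. \<Sum>j\<in>dests I. ?X i j r a)"
    by (simp add: link_flows_def)
  also have "\<dots> = (\<Sum>r\<in>UNIV. \<Sum>i\<in>origins I. \<Sum>a\<in>UNIV. \<Sum>j\<in>dests I. ?X i j r a)"
    by (intro sum.cong refl sum.swap)
  also have "\<dots> = (\<Sum>i\<in>origins I. \<Sum>r\<in>UNIV. \<Sum>a\<in>UNIV. \<Sum>j\<in>dests I. ?X i j r a)"
    by (rule sum.swap)
  also have "\<dots> = (\<Sum>i\<in>origins I. \<Sum>r\<in>UNIV. \<Sum>j\<in>dests I. \<Sum>a\<in>UNIV. ?X i j r a)"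
    by (intro sum.cong refl sum.swap)
  also have "\<dots> = od_sum ?X" unfolding od_sum_def by (intro sum.cong refl sum.swap)
  also have "\<dots> = od_sum (\<lambda>i j r a. \<Sum>p\<in>paths I i j m. x i j r a m p *\<^sub>R path_vec p) $ e"
    unfolding od_sum_component
  proof (rule od_sum_cong)
    fix i j r a assume "i \<in> origins I" "j \<in> dests I"
    then have "?X i j r a = (\<Sum>p\<in>paths I i j m. if e \<in> set p then x i j r a m p else 0)"
      by (intro sum.inter_filter finite_paths)
    then show "?X i j r a = (\<Sum>p\<in>paths I i j m. x i j r a m p *\<^sub>R path_vec p) $ e"
      by (simp add: path_vec_def if_distrib cong: if_cong)
  qed
  finally show "link_flows I x m $ e = od_sum (\<lambda>i j r a. \<Sum>p\<in>paths I i j m. x i j r a m p *\<^sub>R path_vec p) $ e" .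
qed

section \<open>Cost of link flows and shortest path assignments\<close>

definition travel_cost :: "real ^ 'e \<Rightarrow> ('m \<Rightarrow> real ^ 'e) \<Rightarrow> real" where
  "travel_cost t f = (\<Sum>m\<in>UNIV. (t + mode_cost_vec m) \<bullet> f m)"

text \<open>For fixed flows the cost is affine in the times with slope \<open>total_flow f\<close>;
  this makes total flows supergradients.\<close>

lemma travel_cost_eq: "travel_cost t f = t \<bullet> total_flow f + travel_cost 0 f"
  by (simp add: travel_cost_def total_flow_def inner_add_left sum.distrib inner_sum_right)

lemma travel_cost_link_flows:
  "travel_cost t (link_flows I x)
    = od_sum (\<lambda>i j r a. \<Sum>m\<in>UNIV. \<Sum>p\<in>paths I i j m. x i j r a m p * path_cost I t m p)"
  unfolding travel_cost_def od_sum_sum link_flows_od_sum od_sum_inner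
  by (simp add: inner_sum_right path_cost_inner)

text \<open>
  The property of the flows \<open>f\<close> induced by the demand \<open>d\<close> that weak duality needs. Unlike
  membership in the image of \<open>link_flows\<close>, it is visibly stable under convex combinations.
\<close>

definition serves :: "('m \<Rightarrow> real ^ 'e) \<Rightarrow> ('v, 'r, 'a, 'm) mode_demand \<Rightarrow> bool" where
  "serves f d \<longleftrightarrow>
     (\<forall>t. od_sum (\<lambda>i j r a. \<Sum>m\<in>UNIV. d i j r a m * mode_time I t i j m) \<le> travel_cost t f)"

lemma path_flows_serve:
  assumes "x \<in> path_flows I d"
  shows "serves (link_flows I x) d"
  unfolding serves_def travel_cost_link_flows
proof (intro allI od_sum_mono sum_mono)
  fix t i j r a m assume ij: "i \<in> origins I" "j \<in> dests I"
  have "d i j r a m * mode_time I t i j m = (\<Sum>p\<in>paths I i j m. x i j r a m p * mode_time I t i j m)"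
    using assms ij unfolding path_flows_def by (auto simp: sum_distrib_right[symmetric])
  also have "\<dots> \<le> (\<Sum>p\<in>paths I i j m. x i j r a m p * path_cost I t m p)"
    using assms ij unfolding path_flows_def by (intro sum_mono mult_left_mono mode_time_le) auto
  finally show "d i j r a m * mode_time I t i j m \<le> (\<Sum>p\<in>paths I i j m. x i j r a m p * path_cost I t m p)" .
qed

lemma shortest_path_flows_serve:
  assumes "f \<in> shortest_path_flows I t d"
  shows "serves f d"
  using assms path_flows_serve unfolding shortest_path_flows_def by auto

lemma shortest_path_flows_cost:
  assumes "f \<in> shortest_path_flows I t d"
  shows "travel_cost t f = od_sum (\<lambda>i j r a. \<Sum>m\<in>UNIV. d i j r a m * mode_time I t i j m)"
proof -
  obtain x where f: "f = link_flows I x" and x: "x \<in> path_flows I d"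
    and sp: "\<And>i j r a m p. \<lbrakk>i \<in> origins I; j \<in> dests I; p \<in> paths I i j m; x i j r a m p \<noteq> 0\<rbrakk>
      \<Longrightarrow> path_cost I t m p = mode_time I t i j m"
    using assms unfolding shortest_path_flows_def by auto
  show ?thesis unfolding f travel_cost_link_flows
  proof (intro od_sum_cong sum.cong refl)
    fix i j r a m assume ij: "i \<in> origins I" "j \<in> dests I"
    have "(\<Sum>p\<in>paths I i j m. x i j r a m p * path_cost I t m p)
        = (\<Sum>p\<in>paths I i j m. x i j r a m p * mode_time I t i j m)"
    proof (intro sum.cong refl)
      fix p assume "p \<in> paths I i j m"
      then show "x i j r a m p * path_cost I t m p = x i j r a m p * mode_time I t i j m"
        using sp[OF ij, of p m r a] by (cases "x i j r a m p = 0") simp_all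
    qed
    also have "\<dots> = d i j r a m * mode_time I t i j m"
      using x ij unfolding path_flows_def by (auto simp: sum_distrib_right[symmetric])
    finally show "(\<Sum>p\<in>paths I i j m. x i j r a m p * path_cost I t m p) = d i j r a m * mode_time I t i j m" .
  qed
qed

text \<open>All-or-nothing assignment: one chosen shortest path carries the whole demand of each
  pair and mode.\<close>

lemma shortest_path_flows_nonempty:
  assumes "\<And>i j r a m. i \<in> origins I \<Longrightarrow> j \<in> dests I \<Longrightarrow> 0 \<le> d i j r a m"
  shows "shortest_path_flows I t d \<noteq> {}"
proof -
  define best where "best i j m = (SOME p. p \<in> paths I i j m \<and> path_cost I t m p = mode_time I t i j m)"
    for i j m
  have best: "best i j m \<in> paths I i j m \<and> path_cost I t m (best i j m) = mode_time I t i j m"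
    if "i \<in> origins I" "j \<in> dests I" for i j m
    unfolding best_def using shortest_path_exists[OF that] by (metis (mono_tags, lifting) someI_ex)
  define x where "x i j r a m p = (if p = best i j m then d i j r a m else 0)" for i j r a m p
  have "x \<in> path_flows I d"
    unfolding path_flows_def x_def using assms best finite_paths by (auto simp: sum.delta)
  moreover have "path_cost I t m p = mode_time I t i j m"
    if "i \<in> origins I" "j \<in> dests I" "x i j r a m p \<noteq> 0" for i j r a m p
    using best[OF that(1,2)] that(3) by (auto simp: x_def split: if_splits)
  ultimately have "link_flows I x \<in> shortest_path_flows I t d"
    unfolding shortest_path_flows_def by blast
  then show ?thesis by auto
qed

section \<open>Demand and duality\<close>

text \<open>The polytope \<open>\<Pi>'(l, w)\<close> of demands split by mode.\<close>

definition mode_tables :: "('v, 'r, 'a, 'm) mode_demand set" where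
  "mode_tables = {d. (\<forall>i\<in>origins I. \<forall>j\<in>dests I. \<forall>r a m. 0 \<le> d i j r a m) \<and>
     (\<lambda>i j r a. \<Sum>m\<in>UNIV. d i j r a m) \<in> trip_tables I}"

lemma od_sum_trip_table:
  assumes "d \<in> trip_tables I"
  shows "od_sum d = total_demand I"
proof -
  have "od_sum d = (\<Sum>i\<in>origins I. \<Sum>r\<in>UNIV. \<Sum>j\<in>dests I. \<Sum>a\<in>UNIV. d i j r a)"
    unfolding od_sum_def by (intro sum.cong refl sum.swap)
  also have "\<dots> = (\<Sum>r\<in>UNIV. \<Sum>i\<in>origins I. \<Sum>j\<in>dests I. \<Sum>a\<in>UNIV. d i j r a)" by (rule sum.swap)
  also have "\<dots> = (\<Sum>r\<in>UNIV. \<Sum>j\<in>dests I. \<Sum>i\<in>origins I. \<Sum>a\<in>UNIV. d i j r a)"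
    by (intro sum.cong refl sum.swap)
  also have "\<dots> = total_demand I"
    using assms unfolding total_demand_def trip_tables_def by (intro sum.cong refl) auto
  finally show ?thesis .
qed

lemma total_link_flows:
  "total_flow (link_flows I x)
    = od_sum (\<lambda>i j r a. \<Sum>m\<in>UNIV. \<Sum>p\<in>paths I i j m. x i j r a m p *\<^sub>R path_vec p)"
  unfolding total_flow_def link_flows_od_sum od_sum_sum ..

text \<open>The total flow is a nonnegative combination of path incidence vectors with total mass
  \<open>total_demand I\<close>.\<close>

lemma flow_bounds:
  assumes f: "f \<in> shortest_path_flows I t d" and d: "d \<in> mode_tables"
  shows "norm (total_flow f) \<le> sqrt (real (max_links I)) * total_demand I"
    and "0 \<le> total_flow f $ e" and "total_flow f $ e \<le> total_demand I"
proof -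
  obtain x where f: "f = link_flows I x" and x: "x \<in> path_flows I d"
    using f unfolding shortest_path_flows_def by auto
  have x0: "0 \<le> x i j r a m p" if "i \<in> origins I" "j \<in> dests I" "p \<in> paths I i j m" for i j r a m p
    using x that unfolding path_flows_def by auto
  have total: "od_sum (\<lambda>i j r a. \<Sum>m\<in>UNIV. \<Sum>p\<in>paths I i j m. x i j r a m p) = total_demand I"
  proof -
    have "od_sum (\<lambda>i j r a. \<Sum>m\<in>UNIV. \<Sum>p\<in>paths I i j m. x i j r a m p)
        = od_sum (\<lambda>i j r a. \<Sum>m\<in>UNIV. d i j r a m)"
      using x unfolding path_flows_def by (intro od_sum_cong sum.cong refl) auto
    then show ?thesis using d od_sum_trip_table unfolding mode_tables_def by auto
  qed
  have "norm (total_flow f) \<le> od_sum (\<lambda>i j r a. norm (\<Sum>m\<in>UNIV. \<Sum>p\<in>paths I i j m. x i j r a m p *\<^sub>R path_vec p))"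
    unfolding f total_link_flows by (rule norm_od_sum)
  also have "\<dots> \<le> od_sum (\<lambda>i j r a. sqrt (real (max_links I)) * (\<Sum>m\<in>UNIV. \<Sum>p\<in>paths I i j m. x i j r a m p))"
  proof (rule od_sum_mono)
    fix i j r a assume ij: "i \<in> origins I" "j \<in> dests I"
    have "norm (\<Sum>m\<in>UNIV. \<Sum>p\<in>paths I i j m. x i j r a m p *\<^sub>R path_vec p)
        \<le> (\<Sum>m\<in>UNIV. \<Sum>p\<in>paths I i j m. norm (x i j r a m p *\<^sub>R path_vec p))"
      by (intro order_trans[OF norm_sum] sum_mono order_refl)
    also have "\<dots> \<le> (\<Sum>m\<in>UNIV. \<Sum>p\<in>paths I i j m. sqrt (real (max_links I)) * x i j r a m p)"
      using x0[OF ij] norm_path_vec[OF ij]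
      by (intro sum_mono) (auto simp: mult.commute[of "sqrt (real (max_links I))"] intro!: mult_left_mono)
    finally show "norm (\<Sum>m\<in>UNIV. \<Sum>p\<in>paths I i j m. x i j r a m p *\<^sub>R path_vec p)
        \<le> sqrt (real (max_links I)) * (\<Sum>m\<in>UNIV. \<Sum>p\<in>paths I i j m. x i j r a m p)"
      by (simp add: sum_distrib_left)
  qed
  also have "\<dots> = sqrt (real (max_links I)) * total_demand I"
    unfolding od_sum_left[symmetric] total ..
  finally show "norm (total_flow f) \<le> sqrt (real (max_links I)) * total_demand I" .
  have comp: "total_flow f $ e
      = od_sum (\<lambda>i j r a. \<Sum>m\<in>UNIV. \<Sum>p\<in>paths I i j m. x i j r a m p * (if e \<in> set p then 1 else 0))"
    unfolding f total_link_flows od_sum_component by (simp add: path_vec_def)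
  have "od_sum (\<lambda>i j r a. 0) \<le> total_flow f $ e"
    unfolding comp using x0 by (intro od_sum_mono sum_nonneg) auto
  then show "0 \<le> total_flow f $ e" by (simp add: od_sum_def)
  show "total_flow f $ e \<le> total_demand I"
    unfolding comp total[symmetric] using x0 by (intro od_sum_mono sum_mono) auto
qed

lemma E_fun_od_sum:
  "E_fun I d t = od_sum (\<lambda>i j r a. d i j r a * agent_time I t i j a + 1 / gamma I r * d i j r a * ln (d i j r a))"
  by (simp add: E_fun_def od_sum_def sum.distrib)

lemma entropy_od_sum:
  "entropy I d = od_sum (\<lambda>i j r a.
     1 / gamma I r * (\<Sum>m\<in>UNIV. d i j r a m) * ln (\<Sum>m\<in>UNIV. d i j r a m)
     + (\<Sum>m\<in>UNIV. 1 / alpha I a * d i j r a m * (ln (d i j r a m / (\<Sum>m\<in>UNIV. d i j r a m)) + beta I a m)))"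
  by (simp add: entropy_def od_sum_def sum.distrib)

lemma E_fun_le_lagrangian:
  assumes d: "d \<in> mode_tables" and f: "serves f d"
  shows "E_fun I (\<lambda>i j r a. \<Sum>m\<in>UNIV. d i j r a m) t \<le> entropy I d + travel_cost t f"
proof -
  have "E_fun I (\<lambda>i j r a. \<Sum>m\<in>UNIV. d i j r a m) t
      \<le> entropy I d + od_sum (\<lambda>i j r a. \<Sum>m\<in>UNIV. d i j r a m * mode_time I t i j m)"
    unfolding E_fun_od_sum entropy_od_sum od_sum_add[symmetric]
  proof (rule od_sum_mono)
    fix i j r a assume "i \<in> origins I" "j \<in> dests I"
    then have "0 \<le> d i j r a m" for m using d by (auto simp: mode_tables_def)
    from gibbs_variational(1)[where d = "d i j r a" and T = "mode_time I t i j" and \<beta> = "beta I a",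
        OF alpha_pos[of a] this]
    show "(\<Sum>m\<in>UNIV. d i j r a m) * agent_time I t i j a
          + 1 / gamma I r * (\<Sum>m\<in>UNIV. d i j r a m) * ln (\<Sum>m\<in>UNIV. d i j r a m)
        \<le> 1 / gamma I r * (\<Sum>m\<in>UNIV. d i j r a m) * ln (\<Sum>m\<in>UNIV. d i j r a m)
          + (\<Sum>m\<in>UNIV. 1 / alpha I a * d i j r a m * (ln (d i j r a m / (\<Sum>m\<in>UNIV. d i j r a m)) + beta I a m))
          + (\<Sum>m\<in>UNIV. d i j r a m * mode_time I t i j m)"
      unfolding agent_time_def by linarith
  qed
  also have "od_sum (\<lambda>i j r a. \<Sum>m\<in>UNIV. d i j r a m * mode_time I t i j m) \<le> travel_cost t f"
    using f by (simp add: serves_def)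
  finally show ?thesis by simp
qed

lemma
  shows sum_mode_split: "(\<Sum>m\<in>UNIV. mode_split I t d i j r a m) = d i j r a"
    and mode_split_nonneg: "0 \<le> d i j r a \<Longrightarrow> 0 \<le> mode_split I t d i j r a m"
proof -
  let ?w = "\<lambda>m. exp (- alpha I a * mode_time I t i j m - beta I a m)"
  have W: "0 < (\<Sum>m\<in>UNIV. ?w m)" by (intro sum_pos) auto
  show "(\<Sum>m\<in>UNIV. mode_split I t d i j r a m) = d i j r a"
    unfolding mode_split_def sum_distrib_left[symmetric] sum_divide_distrib[symmetric] using W by simp
  show "0 \<le> d i j r a \<Longrightarrow> 0 \<le> mode_split I t d i j r a m"
    unfolding mode_split_def using W by (intro mult_nonneg_nonneg divide_nonneg_nonneg) auto
qed

lemma mode_split_mode_tables: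
  assumes "d \<in> trip_tables I"
  shows "mode_split I t d \<in> mode_tables"
  using assms mode_split_nonneg by (auto simp: mode_tables_def trip_tables_def sum_mode_split)

text \<open>The two inequalities behind \<open>E_fun_le_lagrangian\<close> are tight here: Gibbs for
  the logit split, and \<open>serves\<close> for shortest paths.\<close>

lemma E_fun_eq_lagrangian:
  assumes d: "d \<in> trip_tables I" and f: "f \<in> shortest_path_flows I t (mode_split I t d)"
  shows "E_fun I d t = entropy I (mode_split I t d) + travel_cost t f"
  unfolding E_fun_od_sum entropy_od_sum shortest_path_flows_cost[OF f] od_sum_add[symmetric]
proof (rule od_sum_cong)
  fix i j r a assume ij: "i \<in> origins I" "j \<in> dests I"
  let ?s = "mode_split I t d i j r a"
  have "0 \<le> ?s m" for m using mode_split_nonneg d ij by (auto simp: trip_tables_def)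
  from gibbs_variational(2)[OF alpha_pos this mode_split_def]
  show "d i j r a * agent_time I t i j a + 1 / gamma I r * d i j r a * ln (d i j r a)
      = 1 / gamma I r * (\<Sum>m\<in>UNIV. ?s m) * ln (\<Sum>m\<in>UNIV. ?s m)
        + (\<Sum>m\<in>UNIV. 1 / alpha I a * ?s m * (ln (?s m / (\<Sum>m\<in>UNIV. ?s m)) + beta I a m))
        + (\<Sum>m\<in>UNIV. ?s m * mode_time I t i j m)"
    unfolding agent_time_def sum_mode_split by linarith
qed

text \<open>Freeze the split and the flow found at \<open>z\<close>: the Lagrangian is then affine
  in the times, bounds \<open>E_fun\<close> everywhere and touches it at \<open>z\<close>.\<close>

lemma E_fun_supergradient:
  assumes d: "d \<in> trip_tables I" and f: "f \<in> shortest_path_flows I z (mode_split I z d)"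
  shows "E_fun I d t \<le> E_fun I d z + total_flow f \<bullet> (t - z)"
  using E_fun_le_lagrangian[OF mode_split_mode_tables[OF d] shortest_path_flows_serve[OF f], of t]
    E_fun_eq_lagrangian[OF d f] travel_cost_eq[of t f] travel_cost_eq[of z f]
  unfolding sum_mode_split by (simp add: inner_diff_right inner_commute)

text \<open>The infimum bounds its members only if the values are bounded below: trips lie between 0
  and the departures, and \<open>x ln x \<ge> -1\<close>.\<close>

lemma E_min_le:
  assumes "d \<in> trip_tables I"
  shows "E_min I t \<le> E_fun I d t"
proof -
  have "od_sum (\<lambda>i j r a. - (departures I i r a * \<bar>agent_time I t i j a\<bar> + 1 / gamma I r)) \<le> E_fun I d t"
    if d: "d \<in> trip_tables I" for d
    unfolding E_fun_od_sum
  proof (rule od_sum_mono)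
    fix i j r a assume ij: "i \<in> origins I" "j \<in> dests I"
    have d0: "0 \<le> d i j r a" using d ij by (auto simp: trip_tables_def)
    have "d i j r a \<le> (\<Sum>j\<in>dests I. d i j r a)"
      using d ij finite_dests by (intro member_le_sum) (auto simp: trip_tables_def)
    also have "\<dots> = departures I i r a" using d ij by (auto simp: trip_tables_def)
    finally have "d i j r a * \<bar>agent_time I t i j a\<bar> \<le> departures I i r a * \<bar>agent_time I t i j a\<bar>"
      by (intro mult_right_mono) auto
    moreover have "- (d i j r a * \<bar>agent_time I t i j a\<bar>) \<le> d i j r a * agent_time I t i j a"
      using d0 by (simp add: abs_if)
    moreover have "1 / gamma I r * (- 1) \<le> 1 / gamma I r * (d i j r a * ln (d i j r a))"
      using mult_ln_ge[OF d0] gamma_pos[of r] by (intro mult_left_mono) auto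
    ultimately show "- (departures I i r a * \<bar>agent_time I t i j a\<bar> + 1 / gamma I r)
        \<le> d i j r a * agent_time I t i j a + 1 / gamma I r * d i j r a * ln (d i j r a)"
      by (simp add: mult.assoc)
  qed
  then have "bdd_below ((\<lambda>d. E_fun I d t) ` trip_tables I)" by (intro bdd_belowI2)
  then show ?thesis unfolding E_min_def using assms by (rule cINF_lower)
qed

lemma E_min_le_lagrangian:
  assumes "d \<in> mode_tables" "serves f d"
  shows "E_min I t \<le> entropy I d + travel_cost t f"
  using E_fun_le_lagrangian[OF assms] E_min_le assms(1) order_trans
  unfolding mode_tables_def by blast

lemma M_const_nonneg: "0 \<le> M_const I"
  using total_demand_pos by (simp add: M_const_def)

text \<open>Flows are componentwise nonnegative, so their inner product is nonnegative and the
  squared norms merely add. Hence the factor \<open>sqrt 2\<close> in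
  \<open>M_const\<close>.\<close>

lemma flow_difference_bound:
  assumes f: "f \<in> shortest_path_flows I t d" "d \<in> mode_tables"
    and f': "f' \<in> shortest_path_flows I t' d'" "d' \<in> mode_tables"
  shows "norm (total_flow f - total_flow f') \<le> M_const I"
proof -
  let ?B = "sqrt (real (max_links I)) * total_demand I"
  have "0 \<le> total_flow f \<bullet> total_flow f'"
    unfolding inner_vec_def using flow_bounds(2)[OF f] flow_bounds(2)[OF f'] by (intro sum_nonneg) auto
  then have "(norm (total_flow f - total_flow f'))\<^sup>2 \<le> (norm (total_flow f))\<^sup>2 + (norm (total_flow f'))\<^sup>2"
    unfolding power2_norm_eq_inner by (simp add: inner_diff inner_commute)
  also have "\<dots> \<le> ?B\<^sup>2 + ?B\<^sup>2"
    by (intro add_mono power_mono flow_bounds(1)[OF f] flow_bounds(1)[OF f']) auto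
  also have "\<dots> = (M_const I)\<^sup>2" by (simp add: M_const_def power_mult_distrib)
  finally show ?thesis using M_const_nonneg by (rule power2_le_imp_le)
qed

text \<open>The minorant is the supergradient inequality with signs reversed. For the upper bound,
  each competitor \<open>d'\<close> at \<open>t\<close> is taken back to \<open>z\<close> along its
  own supergradient and compared there with the nearly optimal \<open>d\<close>; the two slopes
  differ by at most \<open>M_const I\<close>.\<close>

lemma oracle_replies_inexact:
  assumes "(d, g) \<in> oracle_replies I \<delta> z"
  shows "inexact_oracle_at (phi3 I) (M_const I) \<delta> (- E_fun I d z) (- g) z"
  unfolding inexact_oracle_at_def
proof (intro allI conjI)
  fix t
  obtain f where d: "d \<in> trip_tables I" "E_fun I d z \<le> E_min I z + \<delta>"
    and f: "f \<in> shortest_path_flows I z (mode_split I z d)" "g = total_flow f"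
    using assms unfolding oracle_replies_def by auto
  show "- E_fun I d z + - g \<bullet> (t - z) \<le> phi3 I t"
    using E_fun_supergradient[OF d(1) f(1), of t] E_min_le[OF d(1), of t] f(2) by (simp add: phi3_def)
  have "- (- E_fun I d z + - g \<bullet> (t - z) + M_const I * norm (t - z) + \<delta>) \<le> E_min I t"
    unfolding E_min_def
  proof (rule cINF_greatest)
    show "trip_tables I \<noteq> {}" using d by auto
    fix d' assume d': "d' \<in> trip_tables I"
    obtain f' where f': "f' \<in> shortest_path_flows I t (mode_split I t d')"
      using shortest_path_flows_nonempty mode_split_mode_tables[OF d'] unfolding mode_tables_def by blast
    have "(g - total_flow f') \<bullet> (t - z) \<le> norm (g - total_flow f') * norm (t - z)"
      by (rule norm_cauchy_schwarz)
    also have "\<dots> \<le> M_const I * norm (t - z)"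
      unfolding f(2)
      by (intro mult_right_mono flow_difference_bound[OF f(1) _ f'] mode_split_mode_tables d(1) d') auto
    finally have "(g - total_flow f') \<bullet> (t - z) \<le> M_const I * norm (t - z)" .
    moreover have "E_fun I d z - \<delta> \<le> E_fun I d' t + total_flow f' \<bullet> (z - t)"
      using d(2) E_min_le[OF d', of z] E_fun_supergradient[OF d' f', of z] by simp
    ultimately show "- (- E_fun I d z + - g \<bullet> (t - z) + M_const I * norm (t - z) + \<delta>) \<le> E_fun I d' t"
      by (simp add: inner_diff_left inner_diff_right)
  qed
  then show "phi3 I t \<le> - E_fun I d z + - g \<bullet> (t - z) + M_const I * norm (t - z) + \<delta>"
    by (simp add: phi3_def)
qed

section \<open>Convex combinations\<close>

lemma travel_cost_sum: "travel_cost t (\<lambda>m. \<Sum>k\<in>K. w k *\<^sub>R f k m) = (\<Sum>k\<in>K. w k * travel_cost t (f k))"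
  unfolding travel_cost_def by (simp add: inner_sum_right sum_distrib_left sum.swap[of _ K])

lemma total_flow_sum: "total_flow (\<lambda>m. \<Sum>k\<in>K. w k *\<^sub>R f k m) = (\<Sum>k\<in>K. w k *\<^sub>R total_flow (f k))"
  unfolding total_flow_def by (simp add: scaleR_sum_right sum.swap[of _ K])

context
  fixes K :: "'k set" and w :: "'k \<Rightarrow> real"
  assumes K: "finite K" and w_nonneg: "\<And>k. k \<in> K \<Longrightarrow> 0 \<le> w k" and w_sum: "sum w K = 1"
begin

lemma entropy_convex:
  assumes d: "\<And>k. k \<in> K \<Longrightarrow> d k \<in> mode_tables"
  shows "entropy I (\<lambda>i j r a m. \<Sum>k\<in>K. w k * d k i j r a m) \<le> (\<Sum>k\<in>K. w k * entropy I (d k))"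
  unfolding entropy_od_sum od_sum_left od_sum_sum[symmetric]
proof (rule od_sum_mono)
  fix i j r a assume ij: "i \<in> origins I" "j \<in> dests I"
  have d0: "0 \<le> d k i j r a m" if "k \<in> K" for k m using d[OF that] ij by (auto simp: mode_tables_def)
  let ?D = "\<lambda>k. \<Sum>m\<in>UNIV. d k i j r a m"
  let ?x = "\<lambda>m. \<Sum>k\<in>K. w k * d k i j r a m"
  let ?X = "\<Sum>k\<in>K. w k * ?D k"
  have X: "(\<Sum>m\<in>UNIV. ?x m) = ?X" unfolding sum_distrib_left by (rule sum.swap)
  have D0: "0 \<le> ?D k" if "k \<in> K" for k using d0[OF that] by (intro sum_nonneg) auto
  \<comment> \<open>Log-sum against the constant 1, whose weighted total is 1. The modal part below
    uses log-sum against the totals \<open>?D k\<close>, and the \<open>beta\<close> terms are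
    linear.\<close>
  have "?X * ln (?X / (\<Sum>k\<in>K. w k * 1)) \<le> (\<Sum>k\<in>K. w k * (?D k * ln (?D k / 1)))"
    using K w_nonneg D0 by (intro log_sum_inequality) auto
  then have 1: "1 / gamma I r * (?X * ln ?X) \<le> 1 / gamma I r * (\<Sum>k\<in>K. w k * (?D k * ln (?D k)))"
    using gamma_pos[of r] w_sum by (intro mult_left_mono) auto
  have 2: "1 / alpha I a * ?x m * (ln (?x m / ?X) + beta I a m)
      \<le> (\<Sum>k\<in>K. w k * (1 / alpha I a * d k i j r a m * (ln (d k i j r a m / ?D k) + beta I a m)))" for m
  proof -
    have "d k i j r a m = 0" if "k \<in> K" "?D k = 0" for k
      using that d0[OF that(1)] by (simp add: sum_nonneg_eq_0_iff)
    then have "?x m * ln (?x m / ?X) \<le> (\<Sum>k\<in>K. w k * (d k i j r a m * ln (d k i j r a m / ?D k)))"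
      using K w_nonneg D0 d0 by (intro log_sum_inequality) auto
    moreover have "?x m * beta I a m = (\<Sum>k\<in>K. w k * (d k i j r a m * beta I a m))"
      by (simp add: sum_distrib_right mult.assoc)
    ultimately have "?x m * (ln (?x m / ?X) + beta I a m)
        \<le> (\<Sum>k\<in>K. w k * (d k i j r a m * (ln (d k i j r a m / ?D k) + beta I a m)))"
      by (simp add: distrib_left sum.distrib)
    then have "1 / alpha I a * (?x m * (ln (?x m / ?X) + beta I a m))
        \<le> 1 / alpha I a * (\<Sum>k\<in>K. w k * (d k i j r a m * (ln (d k i j r a m / ?D k) + beta I a m)))"
      using alpha_pos[of a] by (intro mult_left_mono) auto
    also have "\<dots> = (\<Sum>k\<in>K. w k * (1 / alpha I a * d k i j r a m * (ln (d k i j r a m / ?D k) + beta I a m)))"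
      unfolding sum_distrib_left[of "1 / alpha I a"] by (simp only: mult_ac)
    finally show ?thesis by (simp only: mult.assoc)
  qed
  have 3: "(\<Sum>m\<in>UNIV. 1 / alpha I a * ?x m * (ln (?x m / ?X) + beta I a m))
      \<le> (\<Sum>k\<in>K. w k * (\<Sum>m\<in>UNIV. 1 / alpha I a * d k i j r a m * (ln (d k i j r a m / ?D k) + beta I a m)))"
  proof -
    have "(\<Sum>m\<in>UNIV. 1 / alpha I a * ?x m * (ln (?x m / ?X) + beta I a m))
        \<le> (\<Sum>m\<in>UNIV. \<Sum>k\<in>K. w k * (1 / alpha I a * d k i j r a m * (ln (d k i j r a m / ?D k) + beta I a m)))"
      by (intro sum_mono 2)
    also have "\<dots> = (\<Sum>k\<in>K. \<Sum>m\<in>UNIV. w k * (1 / alpha I a * d k i j r a m * (ln (d k i j r a m / ?D k) + beta I a m)))"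
      by (rule sum.swap)
    finally show ?thesis by (simp only: sum_distrib_left)
  qed
  show "1 / gamma I r * (\<Sum>m\<in>UNIV. ?x m) * ln (\<Sum>m\<in>UNIV. ?x m)
        + (\<Sum>m\<in>UNIV. 1 / alpha I a * ?x m * (ln (?x m / (\<Sum>m\<in>UNIV. ?x m)) + beta I a m))
      \<le> (\<Sum>k\<in>K. w k * (1 / gamma I r * ?D k * ln (?D k)
        + (\<Sum>m\<in>UNIV. 1 / alpha I a * d k i j r a m * (ln (d k i j r a m / ?D k) + beta I a m))))"
  proof -
    have "(\<Sum>k\<in>K. w k * (1 / gamma I r * ?D k * ln (?D k)
        + (\<Sum>m\<in>UNIV. 1 / alpha I a * d k i j r a m * (ln (d k i j r a m / ?D k) + beta I a m))))
      = 1 / gamma I r * (\<Sum>k\<in>K. w k * (?D k * ln (?D k)))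
        + (\<Sum>k\<in>K. w k * (\<Sum>m\<in>UNIV. 1 / alpha I a * d k i j r a m * (ln (d k i j r a m / ?D k) + beta I a m)))"
    proof -
      have "(\<Sum>k\<in>K. w k * (g * D k * L k + T k)) = g * (\<Sum>k\<in>K. w k * (D k * L k)) + (\<Sum>k\<in>K. w k * T k)"
        for g :: real and D L T :: "'k \<Rightarrow> real"
        by (simp add: distrib_left sum.distrib sum_distrib_left mult_ac)
      then show ?thesis .
    qed
    then show ?thesis unfolding X using 1 3 by (simp only: mult.assoc)
  qed
qed

lemma mode_tables_convex:
  assumes d: "\<And>k. k \<in> K \<Longrightarrow> d k \<in> mode_tables"
  shows "(\<lambda>i j r a m. \<Sum>k\<in>K. w k * d k i j r a m) \<in> mode_tables"
proof -
  let ?D = "\<lambda>k i j r a. \<Sum>m\<in>UNIV. d k i j r a m"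
  have D: "(\<Sum>m\<in>UNIV. \<Sum>k\<in>K. w k * d k i j r a m) = (\<Sum>k\<in>K. w k * ?D k i j r a)" for i j r a
    unfolding sum_distrib_left by (rule sum.swap)
  have tt: "?D k \<in> trip_tables I" if "k \<in> K" for k using d[OF that] by (simp add: mode_tables_def)
  have avg: "(\<Sum>k\<in>K. w k * c) = c" for c using w_sum by (simp add: sum_distrib_right[symmetric])
  have dep: "(\<Sum>j\<in>dests I. \<Sum>k\<in>K. w k * ?D k i j r a) = departures I i r a" if "i \<in> origins I" for i r a
  proof -
    have "(\<Sum>j\<in>dests I. \<Sum>k\<in>K. w k * ?D k i j r a) = (\<Sum>k\<in>K. w k * (\<Sum>j\<in>dests I. ?D k i j r a))"
      unfolding sum.swap[of _ K] by (simp only: sum_distrib_left)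
    also have "\<dots> = (\<Sum>k\<in>K. w k * departures I i r a)"
      using tt that by (intro sum.cong refl) (simp add: trip_tables_def)
    finally show ?thesis unfolding avg .
  qed
  have arr: "(\<Sum>i\<in>origins I. \<Sum>a\<in>UNIV. \<Sum>k\<in>K. w k * ?D k i j r a) = arrivals I j r" if "j \<in> dests I" for j r
  proof -
    have "(\<Sum>i\<in>origins I. \<Sum>a\<in>UNIV. \<Sum>k\<in>K. w k * ?D k i j r a)
        = (\<Sum>k\<in>K. w k * (\<Sum>i\<in>origins I. \<Sum>a\<in>UNIV. ?D k i j r a))"
      unfolding sum.swap[of _ K] by (simp only: sum_distrib_left)
    also have "\<dots> = (\<Sum>k\<in>K. w k * arrivals I j r)"
      using tt that by (intro sum.cong refl) (simp add: trip_tables_def)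
    finally show ?thesis unfolding avg .
  qed
  have "0 \<le> (\<Sum>k\<in>K. w k * ?D k i j r a)" if "i \<in> origins I" "j \<in> dests I" for i j r a
    using d that w_nonneg by (intro sum_nonneg mult_nonneg_nonneg) (auto simp: mode_tables_def)
  moreover have "0 \<le> (\<Sum>k\<in>K. w k * d k i j r a m)" if "i \<in> origins I" "j \<in> dests I" for i j r a m
    using d that w_nonneg by (intro sum_nonneg mult_nonneg_nonneg) (auto simp: mode_tables_def)
  ultimately show ?thesis unfolding mode_tables_def trip_tables_def mem_Collect_eq D using dep arr by blast
qed

lemma serves_convex:
  assumes "\<And>k. k \<in> K \<Longrightarrow> serves (f k) (d k)"
  shows "serves (\<lambda>m. \<Sum>k\<in>K. w k *\<^sub>R f k m) (\<lambda>i j r a m. \<Sum>k\<in>K. w k * d k i j r a m)"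
  unfolding serves_def
proof
  fix t
  have "od_sum (\<lambda>i j r a. \<Sum>m\<in>UNIV. (\<Sum>k\<in>K. w k * d k i j r a m) * mode_time I t i j m)
      = (\<Sum>k\<in>K. w k * od_sum (\<lambda>i j r a. \<Sum>m\<in>UNIV. d k i j r a m * mode_time I t i j m))"
    unfolding od_sum_left od_sum_sum[symmetric] sum_distrib_left sum_distrib_right sum.swap[of _ K]
    by (simp only: mult.assoc)
  also have "\<dots> \<le> (\<Sum>k\<in>K. w k * travel_cost t (f k))"
    using assms w_nonneg unfolding serves_def by (intro sum_mono mult_left_mono) auto
  finally show "od_sum (\<lambda>i j r a. \<Sum>m\<in>UNIV. (\<Sum>k\<in>K. w k * d k i j r a m) * mode_time I t i j m)
      \<le> travel_cost t (\<lambda>m. \<Sum>k\<in>K. w k *\<^sub>R f k m)" unfolding travel_cost_sum .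
qed

lemma total_flow_convex_bounds:
  assumes f: "\<And>k. k \<in> K \<Longrightarrow> f k \<in> shortest_path_flows I (y k) (d k)" "\<And>k. k \<in> K \<Longrightarrow> d k \<in> mode_tables"
  defines "F \<equiv> total_flow (\<lambda>m. \<Sum>k\<in>K. w k *\<^sub>R f k m)"
  shows "norm F \<le> sqrt (real (max_links I)) * total_demand I"
    and "0 \<le> F $ e" and "F $ e \<le> total_demand I"
proof -
  note fb = flow_bounds[OF f]
  have avg: "(\<Sum>k\<in>K. w k * c) = c" for c using w_sum by (simp add: sum_distrib_right[symmetric])
  have "norm F \<le> (\<Sum>k\<in>K. w k * (sqrt (real (max_links I)) * total_demand I))"
    unfolding F_def total_flow_sum using w_nonneg fb(1)
    by (intro sum_norm_le) (simp add: mult_left_mono)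
  then show "norm F \<le> sqrt (real (max_links I)) * total_demand I" unfolding avg .
  have Fe: "F $ e = (\<Sum>k\<in>K. w k * total_flow (f k) $ e)" unfolding F_def total_flow_sum by simp
  show "0 \<le> F $ e" unfolding Fe using w_nonneg fb(2) by (intro sum_nonneg mult_nonneg_nonneg) auto
  have "F $ e \<le> (\<Sum>k\<in>K. w k * total_demand I)"
    unfolding Fe using w_nonneg fb(3) by (intro sum_mono mult_left_mono) auto
  then show "F $ e \<le> total_demand I" unfolding avg .
qed

end

section \<open>Primal objective against the Lagrangian\<close>

lemma Psi_eq: "Psi I f = (\<Sum>e\<in>UNIV. sigma I e (total_flow f $ e)) + travel_cost 0 f"
proof -
  have "travel_cost 0 f = (\<Sum>m\<in>UNIV. \<Sum>e\<in>UNIV. mode_cost I e m * f m $ e)"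
    by (simp add: travel_cost_def inner_vec_def mode_cost_vec_def)
  also have "\<dots> = (\<Sum>e\<in>UNIV. \<Sum>m\<in>UNIV. mode_cost I e m * f m $ e)" by (rule sum.swap)
  finally show ?thesis by (simp add: Psi_def sum.distrib)
qed

lemma D3_eq: "D3 I t = E_min I t - h_fun I t"
  by (simp add: D3_def phi3_def)

text \<open>At the link times of the flow itself Fenchel-Young is an equality on every link.\<close>

lemma P3_Beckmann_eq:
  assumes "congestion I = Beckmann" and F: "\<And>e. 0 \<le> total_flow f $ e"
    and t: "t = (\<chi> e. link_time I e (total_flow f $ e))"
  shows "P3 I f d = entropy I d + travel_cost t f - h_fun I t"
proof -
  have "t \<bullet> total_flow f - h_fun I t = (\<Sum>e\<in>UNIV. sigma I e (total_flow f $ e))"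
    unfolding h_fun_def assms(1) inner_vec_def t
    by (simp add: sigma_conj_link_time[OF assms(1) F] sum_subtractf[symmetric])
  then show ?thesis by (simp add: P3_def Psi_eq travel_cost_eq[of t])
qed

text \<open>Weak duality: Fenchel-Young on each link together with the Lagrangian bound on
  \<open>E_min\<close>.\<close>

lemma P3_Beckmann_ge:
  assumes "congestion I = Beckmann" and F: "\<And>e. 0 \<le> total_flow f $ e" and t: "t \<in> dom_h I"
    and d: "d \<in> mode_tables" "serves f d"
  shows "D3 I t \<le> P3 I f d"
proof -
  have "t \<bullet> total_flow f - h_fun I t = (\<Sum>e\<in>UNIV. t $ e * total_flow f $ e - sigma_conj I e (t $ e))"
    unfolding h_fun_def assms(1) inner_vec_def by (simp add: sum_subtractf)
  also have "\<dots> \<le> (\<Sum>e\<in>UNIV. sigma I e (total_flow f $ e))"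
    using fenchel_young[OF assms(1) _ F] t
    by (intro sum_mono) (auto simp: dom_h_def algebra_simps)
  finally show ?thesis
    using E_min_le_lagrangian[OF d, of t] travel_cost_eq[of t f] by (simp add: P3_def Psi_eq D3_eq)
qed

text \<open>Link costs and \<open>h_fun\<close> are both linear, so the identity holds for every
  \<open>t\<close>, with the capacity violation priced at \<open>t - tbar I\<close>.\<close>

lemma P3_Stable_Dynamics_eq:
  assumes "congestion I = Stable_Dynamics"
  shows "P3 I f d + (total_flow f - fbar I) \<bullet> (t - tbar I) = entropy I d + travel_cost t f - h_fun I t"
proof -
  have "Psi I f = tbar I \<bullet> total_flow f + travel_cost 0 f"
    unfolding Psi_eq by (simp add: sigma_def assms inner_vec_def)
  then show ?thesis
    unfolding P3_def h_fun_def assms travel_cost_eq[of t]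
    by (simp add: inner_diff inner_commute algebra_simps)
qed

text \<open>No link carries more than the total demand, which bounds its delay; this replaces the
  unknown distance to a dual optimum in the Beckmann case.\<close>

lemma link_time_distance:
  assumes "\<And>e. 0 \<le> F $ e \<and> F $ e \<le> total_demand I"
  shows "(norm ((\<chi> e. link_time I e (F $ e)) - tbar I))\<^sup>2 \<le> (R_tilde I)\<^sup>2"
proof -
  have "(norm ((\<chi> e. link_time I e (F $ e)) - tbar I))\<^sup>2 = (\<Sum>e\<in>UNIV. (link_time I e (F $ e) - tbar I $ e)\<^sup>2)"
    unfolding power2_norm_eq_inner inner_vec_def by (simp add: power2_eq_square)
  also have "\<dots> \<le> (\<Sum>e\<in>UNIV. (rho I)\<^sup>2 * total_demand I powr (2 / mu I) * ((tbar I $ e)\<^sup>2 / (fbar I $ e) powr (2 / mu I)))"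
  proof (rule sum_mono)
    fix e
    have "((F $ e / fbar I $ e) powr (1 / mu I))\<^sup>2 = (F $ e / fbar I $ e) powr (2 / mu I)"
      by (simp add: power2_eq_square powr_add[symmetric])
    also have "\<dots> \<le> (total_demand I / fbar I $ e) powr (2 / mu I)"
      using assms[of e] fbar_pos[of e] mu_pos by (intro powr_mono2 divide_right_mono) auto
    also have "\<dots> = total_demand I powr (2 / mu I) / (fbar I $ e) powr (2 / mu I)"
      using total_demand_pos fbar_pos[of e] by (simp add: powr_divide)
    finally have "(rho I * tbar I $ e)\<^sup>2 * ((F $ e / fbar I $ e) powr (1 / mu I))\<^sup>2
        \<le> (rho I * tbar I $ e)\<^sup>2 * (total_demand I powr (2 / mu I) / (fbar I $ e) powr (2 / mu I))"
      by (rule mult_left_mono) simp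
    then show "(link_time I e (F $ e) - tbar I $ e)\<^sup>2
        \<le> (rho I)\<^sup>2 * total_demand I powr (2 / mu I) * ((tbar I $ e)\<^sup>2 / (fbar I $ e) powr (2 / mu I))"
      by (simp add: link_time_def distrib_left power_mult_distrib mult_ac)
  qed
  also have "\<dots> = (R_tilde I)\<^sup>2"
    unfolding R_tilde_def sum_distrib_left[symmetric]
    by (subst real_sqrt_pow2) (auto intro!: mult_nonneg_nonneg sum_nonneg)
  finally show ?thesis .
qed

lemma R_tilde_pos: "0 < R_tilde I"
proof -
  have "0 < (\<Sum>e\<in>UNIV. (tbar I $ e)\<^sup>2 / (fbar I $ e) powr (2 / mu I))"
  proof (intro sum_pos)
    fix e show "0 < (tbar I $ e)\<^sup>2 / (fbar I $ e) powr (2 / mu I)"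
      using tbar_pos[of e] fbar_pos[of e] by (intro divide_pos_pos) auto
  qed auto
  then show ?thesis unfolding R_tilde_def using rho_pos total_demand_pos by simp
qed

end

text \<open>With \<open>u = A R x\<close> the two gap bounds say that
  \<open>u (u - 2 R^2) / 2\<close> is small. If \<open>x\<close> were too large, then
  \<open>u\<close> would exceed \<open>v = 2 \<epsilon> A\<close>, which lies beyond
  \<open>2 R^2\<close>, where this expression increases; so it may be evaluated at
  \<open>v\<close>.\<close>

lemma excess_estimate:
  fixes R :: real
  assumes pos: "0 < \<epsilon>" "0 < R" "0 < B" and R: "R\<^sup>2 \<le> \<epsilon> * B" and A: "5 / 4 * B \<le> A"
    and gap: "A * g + A\<^sup>2 * x\<^sup>2 / 2 \<le> \<epsilon> * (A - 5 / 8 * B)" "- (R * x) \<le> g"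
  shows "x \<le> 2 * \<epsilon> / R"
proof (rule ccontr)
  assume "\<not> x \<le> 2 * \<epsilon> / R"
  then have x: "2 * \<epsilon> < R * x" using pos by (simp add: field_simps)
  have A0: "0 < A" using A pos by simp
  define u v where "u = A * (R * x)" and "v = A * (2 * \<epsilon>)"
  have uv: "v < u" unfolding u_def v_def using x A0 by simp
  have v: "2 * R\<^sup>2 < v"
  proof -
    have "\<epsilon> * B \<le> \<epsilon> * (4 / 5 * A)" using A pos by (intro mult_left_mono) auto
    also have "\<dots> = 4 / 5 * (\<epsilon> * A)" by simp
    finally have "R\<^sup>2 \<le> 4 / 5 * (\<epsilon> * A)" using R by linarith
    moreover have "0 < \<epsilon> * A" using pos A0 by simp
    moreover have "v = 2 * (\<epsilon> * A)" by (simp add: v_def)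
    ultimately show ?thesis by linarith
  qed
  have "A * (- (R * x)) \<le> A * g" by (rule mult_left_mono) (use gap(2) A0 in auto)
  then have "A\<^sup>2 * x\<^sup>2 / 2 - u \<le> \<epsilon> * (A - 5 / 8 * B)" 
    using gap(1) unfolding u_def mult_minus_right by linarith
  then have "R\<^sup>2 * (A\<^sup>2 * x\<^sup>2 / 2 - u) \<le> R\<^sup>2 * (\<epsilon> * (A - 5 / 8 * B))" by (intro mult_left_mono) auto
  moreover have "R\<^sup>2 * (A\<^sup>2 * x\<^sup>2 / 2 - u) = u * (u - 2 * R\<^sup>2) / 2"
    by (simp add: u_def power2_eq_square field_simps)
  moreover have "v * (v - 2 * R\<^sup>2) < u * (u - 2 * R\<^sup>2)"
    using uv v zero_le_power2[of R] by (intro mult_strict_mono) linarith+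
  ultimately have "v * (v - 2 * R\<^sup>2) / 2 < R\<^sup>2 * (\<epsilon> * (A - 5 / 8 * B))" by linarith
  then have "2 * \<epsilon>\<^sup>2 * A\<^sup>2 < \<epsilon> * (R\<^sup>2 * (3 * A - 5 / 8 * B))"
    by (simp add: v_def power2_eq_square algebra_simps diff_divide_distrib)
  also have "\<dots> \<le> \<epsilon> * (\<epsilon> * B * (3 * A - 5 / 8 * B))"
    using R A pos by (intro mult_left_mono mult_right_mono) auto
  finally have "\<epsilon>\<^sup>2 * (2 * A\<^sup>2) < \<epsilon>\<^sup>2 * (B * (3 * A - 5 / 8 * B))"
    by (simp add: power2_eq_square algebra_simps)
  then have "2 * A\<^sup>2 < B * (3 * A - 5 / 8 * B)"
    using pos by (simp add: mult_less_cancel_left)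
  \<comment> \<open>The remaining quadratic in \<open>A\<close> has the roots
    \<open>5 / 4 * B\<close> and \<open>1 / 4 * B\<close>; the assumed lower bound on
    \<open>A\<close> is the larger one.\<close>
  moreover have "0 \<le> (A - 5 / 4 * B) * (A - 1 / 4 * B)" using A pos by simp
  moreover have "2 * A\<^sup>2 - B * (3 * A - 5 / 8 * B) = 2 * ((A - 5 / 4 * B) * (A - 1 / 4 * B))"
    by (simp add: power2_eq_square field_simps)
  ultimately show False by linarith
qed

section \<open>Complexity bounds\<close>

locale traffic_run = traffic I
  for I :: "('v, 'e::finite, 'r::finite, 'a::finite, 'm::finite) traffic_problem" +
  fixes orc :: "('v, 'e, 'r, 'a) oracle_fun" and f :: "nat \<Rightarrow> 'm \<Rightarrow> real ^ 'e" and L0 \<epsilon> :: real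
  assumes eps: "0 < \<epsilon>"
    and L0: "0 < L0" "L0 \<le> (M_const I)\<^sup>2 / \<epsilon>"
    and accurate: "oracle_accurate I orc (tbar I) L0 \<epsilon>"
    and flows: "\<And>k. 1 \<le> k \<Longrightarrow>
        f k \<in> shortest_path_flows I (y_pt (run I orc (tbar I) L0 \<epsilon> k)) (trips_at I orc (tbar I) L0 \<epsilon> k) \<and>
        total_flow (f k) = snd (reply_at I orc (tbar I) L0 \<epsilon> k)"
begin

text \<open>With \<open>M_const I = 0\<close> no positive \<open>L0\<close> could satisfy its upper
  bound.\<close>

lemma M_pos: "0 < M_const I"
  using L0 M_const_nonneg by (cases "M_const I = 0") auto

lemma accurateD:
  assumes "\<forall>j'<j. \<not> ustm_accept \<epsilon> (oracle_val I orc k j') (oracle_grad orc k j') (run_trial I orc (tbar I) L0 \<epsilon> k j')"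
    and "S = run_trial I orc (tbar I) L0 \<epsilon> k j" "z \<in> {y_pt S, t_pt S}"
  shows "orc k j z \<in> oracle_replies I (step S * \<epsilon> / (4 * weight S)) z"
  using accurate assms unfolding oracle_accurate_def Let_def by blast

sublocale inexact_ustm "h_fun I" "phi3 I" "dom_h I" "tbar I" L0 \<epsilon> "M_const I"
  "oracle_val I orc" "oracle_grad orc"
proof
  fix S :: "(real ^ 'e) ustm_state" and k j z
  assume "\<forall>j'<j. \<not> ustm_accept \<epsilon> (oracle_val I orc k j') (oracle_grad orc k j')
        (ustm_trial (h_fun I) (dom_h I) (oracle_val I orc k j') (oracle_grad orc k j')
          (ustm (h_fun I) (dom_h I) (tbar I) L0 \<epsilon> (oracle_val I orc) (oracle_grad orc) k) j')"
    and "S = ustm_trial (h_fun I) (dom_h I) (oracle_val I orc k j) (oracle_grad orc k j)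
          (ustm (h_fun I) (dom_h I) (tbar I) L0 \<epsilon> (oracle_val I orc) (oracle_grad orc) k) j"
    and z: "z \<in> {y_pt S, t_pt S}"
  then have "orc k j z \<in> oracle_replies I (step S * \<epsilon> / (4 * weight S)) z"
    by (intro accurateD) (auto simp: run_trial_def run_def)
  then show "inexact_oracle_at (phi3 I) (M_const I) (step S * \<epsilon> / (4 * weight S))
      (oracle_val I orc k j z) (oracle_grad orc k j z) z"
    using oracle_replies_inexact[of "fst (orc k j z)" "snd (orc k j z)"]
    by (simp add: oracle_val_def oracle_grad_def)
qed (fact h_fun_convex_on h_fun_continuous_on h_fun_nonneg dom_h_closed tbar_dom_h eps M_pos L0)+

lemma run_st: "run I orc (tbar I) L0 \<epsilon> k = st k"
  by (simp add: run_def)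

abbreviation trips :: "nat \<Rightarrow> ('v, 'r, 'a, 'm) mode_demand" where
  "trips k \<equiv> trips_at I orc (tbar I) L0 \<epsilon> k"

abbreviation fK :: "nat \<Rightarrow> 'm \<Rightarrow> real ^ 'e" where
  "fK K \<equiv> f_hat I orc (tbar I) L0 \<epsilon> f K"

abbreviation dK :: "nat \<Rightarrow> ('v, 'r, 'a, 'm) mode_demand" where
  "dK K \<equiv> d_hat I orc (tbar I) L0 \<epsilon> K"

lemma reply_trip_table:
  assumes "1 \<le> k"
  shows "fst (reply_at I orc (tbar I) L0 \<epsilon> k) \<in> trip_tables I"
proof -
  \<comment> \<open>State \<open>k\<close> comes from the accepted trial of iteration
    \<open>k - 1\<close>, the one consulted by \<open>reply_at\<close>.\<close>
  obtain k' where k: "k = Suc k'" using assms by (cases k) auto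
  obtain j where j: "st k = tr k' j" "trial (st k) = j" "\<forall>j'<j. \<not> acc k' j'"
    using st_Suc_trial[OF arg_cong[OF k, of st]] .
  have "orc k' j (y_pt (st k)) \<in> oracle_replies I (step (st k) * \<epsilon> / (4 * weight (st k))) (y_pt (st k))"
  proof (rule accurateD)
    show "\<forall>j'<j. \<not> ustm_accept \<epsilon> (oracle_val I orc k' j') (oracle_grad orc k' j')
        (run_trial I orc (tbar I) L0 \<epsilon> k' j')"
      unfolding run_trial_def run_st by (rule j(3))
    show "st k = run_trial I orc (tbar I) L0 \<epsilon> k' j" unfolding run_trial_def run_st by (rule j(1))
  qed simp
  moreover have "reply_at I orc (tbar I) L0 \<epsilon> k = orc k' j (y_pt (st k))"
    unfolding reply_at_def run_st Let_def j(2) by (simp add: k)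
  ultimately show ?thesis by (simp add: oracle_replies_def case_prod_beta)
qed

lemma trips_mode_tables:
  assumes "1 \<le> k"
  shows "trips k \<in> mode_tables"
  unfolding trips_at_def using reply_trip_table[OF assms] by (rule mode_split_mode_tables)

text \<open>The solver's value is the Lagrangian at \<open>y_pt\<close>, which is affine in the
  times with slope \<open>total_flow (f k)\<close>; hence the base point drops out.\<close>

lemma lower_model_eq:
  assumes "1 \<le> k"
  shows "lower_model k t = - (entropy I (trips k) + travel_cost t (f k))"
proof -
  define d y where "d = fst (reply_at I orc (tbar I) L0 \<epsilon> k)" and "y = y_pt (st k)"
  have f: "f k \<in> shortest_path_flows I y (mode_split I y d)" "total_flow (f k) = snd (reply_at I orc (tbar I) L0 \<epsilon> k)"
    using flows[OF assms] by (simp_all add: trips_at_def run_st d_def y_def)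
  have "lower_model k t = - E_fun I d y - total_flow (f k) \<bullet> (t - y)"
    unfolding lower_model_def f(2) d_def y_def
    by (simp add: oracle_val_def oracle_grad_def reply_at_def run_st Let_def)
  also have "E_fun I d y = entropy I (trips k) + travel_cost y (f k)"
    using E_fun_eq_lagrangian[OF _ f(1)] reply_trip_table[OF assms]
    by (simp add: trips_at_def run_st d_def y_def)
  finally show ?thesis
    unfolding travel_cost_eq[of t] travel_cost_eq[of y] by (simp add: inner_diff_right inner_commute)
qed

section \<open>The averaged flows and trips after \<open>K\<close> iterations\<close>

context
  fixes K :: nat
  assumes K: "1 \<le> K"
begin

definition w :: "nat \<Rightarrow> real" where
  "w k = step (st k) / weight (st K)"

lemma weight_pos: "0 < weight (st K)"
proof -
  have "0 < real K * c" using K c_pos by simp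
  then show ?thesis using weight_ge[of K] by linarith
qed

lemma w: "finite {1..K}" "k \<in> {1..K} \<Longrightarrow> 0 \<le> w k" "sum w {1..K} = 1"
proof -
  show "0 \<le> w k" if k: "k \<in> {1..K}"
  proof -
    obtain k' where "k = Suc k'" using k by (cases k) auto
    then show ?thesis using step_ge[of k'] c_pos weight_pos by (simp add: w_def)
  qed
  show "sum w {1..K} = 1"
    unfolding w_def sum_divide_distrib[symmetric] weight_eq_sum[symmetric] using weight_pos by simp
qed simp

lemma fK_eq: "fK K = (\<lambda>m. \<Sum>k=1..K. w k *\<^sub>R f k m)"
  by (simp add: f_hat_def run_st w_def scaleR_sum_right fun_eq_iff)

lemma dK_eq: "dK K = (\<lambda>i j r a m. \<Sum>k=1..K. w k * trips k i j r a m)"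
  by (simp add: d_hat_def run_st w_def sum_divide_distrib fun_eq_iff)

lemma dK_mode_tables: "dK K \<in> mode_tables"
  unfolding dK_eq using trips_mode_tables by (intro mode_tables_convex w) auto

lemma fK_serves: "serves (fK K) (dK K)"
  unfolding fK_eq dK_eq using shortest_path_flows_serve flows
  by (intro serves_convex w) auto

lemma fK_bounds:
  "norm (total_flow (fK K)) \<le> sqrt (real (max_links I)) * total_demand I"
  "0 \<le> total_flow (fK K) $ e" "total_flow (fK K) $ e \<le> total_demand I"
proof -
  have f: "f k \<in> shortest_path_flows I (y_pt (st k)) (trips k)" "trips k \<in> mode_tables" if "k \<in> {1..K}" for k
    using flows trips_mode_tables that by (auto simp: run_st)
  note b = total_flow_convex_bounds[where K = "{1..K}" and w = w and f = f and d = trips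
      and y = "\<lambda>k. y_pt (st k)", OF w f, folded fK_eq]
  show "norm (total_flow (fK K)) \<le> sqrt (real (max_links I)) * total_demand I" by (rule b(1))
  show "0 \<le> total_flow (fK K) $ e" by (rule b(2))
  show "total_flow (fK K) $ e \<le> total_demand I" by (rule b(3))
qed

text \<open>Travel cost is linear and entropy convex, so the Lagrangian at the averages is at most
  the averaged Lagrangians, which are the minorants in \<open>certificate\<close> up to
  sign.\<close>

lemma duality_gap:
  assumes "t \<in> dom_h I"
  shows "weight (st K) * (entropy I (dK K) + travel_cost t (fK K) - h_fun I t - D3 I (t_pt (st K)))
    \<le> (norm (t - tbar I))\<^sup>2 / 2 + \<epsilon> * (weight (st K) - 5 / 8 * (real K * c))"
proof -
  have "travel_cost t (fK K) = (\<Sum>k=1..K. w k * travel_cost t (f k))"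
    unfolding fK_eq by (rule travel_cost_sum)
  moreover have "entropy I (dK K) \<le> (\<Sum>k=1..K. w k * entropy I (trips k))"
    unfolding dK_eq using trips_mode_tables by (intro entropy_convex w) auto
  ultimately have "entropy I (dK K) + travel_cost t (fK K) \<le> (\<Sum>k=1..K. w k * (entropy I (trips k) + travel_cost t (f k)))"
    by (simp add: distrib_left sum.distrib)
  then have "weight (st K) * (entropy I (dK K) + travel_cost t (fK K))
      \<le> weight (st K) * (\<Sum>k=1..K. w k * (entropy I (trips k) + travel_cost t (f k)))"
    using weight_pos by (intro mult_left_mono) auto
  also have "\<dots> = - (\<Sum>k=1..K. step (st k) * lower_model k t)"
  proof -
    have "weight (st K) * (w k * (entropy I (trips k) + travel_cost t (f k)))
        = - (step (st k) * lower_model k t)" if "1 \<le> k" for k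
      unfolding lower_model_eq[OF that] using weight_pos by (simp add: w_def del: minus_add_distrib)
    then show ?thesis unfolding sum_distrib_left sum_negf[symmetric] by (intro sum.cong refl) auto
  qed
  finally show ?thesis
    using certificate[OF assms, of K] by (simp add: D3_def algebra_simps)
qed

end

text \<open>\<open>\<epsilon> * c\<close> is \<open>\<epsilon>^2 / (4 M^2)\<close>, the reciprocal
  of the factor of \<open>r^2\<close> in the prescribed number of iterations.\<close>

lemma iteration_count:
  assumes "0 < r" "K = nat \<lceil>4 * (M_const I * r / \<epsilon>)\<^sup>2\<rceil>"
  shows "1 \<le> K" and "r\<^sup>2 \<le> \<epsilon> * (real K * c)"
proof -
  have pos: "0 < 4 * (M_const I * r / \<epsilon>)\<^sup>2" using assms(1) M_pos eps by simp
  then show "1 \<le> K" unfolding assms(2) by linarith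
  have "4 * (M_const I * r / \<epsilon>)\<^sup>2 \<le> real K" unfolding assms(2) by linarith
  then have "4 * (M_const I * r / \<epsilon>)\<^sup>2 * (\<epsilon> * c) \<le> real K * (\<epsilon> * c)"
    using eps c_pos by (intro mult_right_mono) auto
  moreover have "4 * (M_const I * r / \<epsilon>)\<^sup>2 * (\<epsilon> * c) = r\<^sup>2"
    using M_pos eps by (simp add: c_def power2_eq_square field_simps)
  ultimately show "r\<^sup>2 \<le> \<epsilon> * (real K * c)" by (simp add: mult_ac)
qed

text \<open>The distance term is at most half of \<open>\<epsilon> K c\<close>, less than the
  \<open>5 / 8\<close> of it saved in the certificate.\<close>

lemma weighted_gap_le:
  assumes "1 \<le> K" "r\<^sup>2 \<le> \<epsilon> * (real K * c)"
    and "weight (st K) * g \<le> r\<^sup>2 / 2 + \<epsilon> * (weight (st K) - 5 / 8 * (real K * c))"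
  shows "g \<le> \<epsilon>"
proof -
  have "0 \<le> \<epsilon> * (real K * c)" using eps c_pos by simp
  then have "weight (st K) * g \<le> weight (st K) * \<epsilon>"
    using assms(2,3) by (simp add: algebra_simps)
  then show ?thesis using weight_pos[OF assms(1)] by simp
qed

theorem Beckmann_gap:
  assumes model: "congestion I = Beckmann" and K: "K = nat \<lceil>4 * (M_const I * R_tilde I / \<epsilon>)\<^sup>2\<rceil>"
  shows "0 \<le> P3 I (fK K) (dK K) - D3 I (t_pt (st K))" and "P3 I (fK K) (dK K) - D3 I (t_pt (st K)) \<le> \<epsilon>"
proof -
  note K1 = iteration_count[OF R_tilde_pos K]
  note F = fK_bounds[OF K1(1)]
  show "0 \<le> P3 I (fK K) (dK K) - D3 I (t_pt (st K))"
    using P3_Beckmann_ge[OF model F(2) t_pt_st dK_mode_tables[OF K1(1)] fK_serves[OF K1(1)]] by simp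
  \<comment> \<open>The comparison point at which the Lagrangian minus \<open>h_fun\<close> is
    exactly \<open>P3\<close> of the averages.\<close>
  define t where "t = (\<chi> e. link_time I e (total_flow (fK K) $ e))"
  have "tbar I $ e \<le> link_time I e (total_flow (fK K) $ e)" for e
    unfolding link_time_def using tbar_pos[of e] rho_pos by simp
  then have t: "t \<in> dom_h I" by (simp add: dom_h_def t_def)
  show "P3 I (fK K) (dK K) - D3 I (t_pt (st K)) \<le> \<epsilon>"
  proof (rule weighted_gap_le[OF K1])
    have "(norm (t - tbar I))\<^sup>2 \<le> (R_tilde I)\<^sup>2"
      unfolding t_def using F(2,3) by (intro link_time_distance) auto
    then show "weight (st K) * (P3 I (fK K) (dK K) - D3 I (t_pt (st K)))
        \<le> (R_tilde I)\<^sup>2 / 2 + \<epsilon> * (weight (st K) - 5 / 8 * (real K * c))"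
      using duality_gap[OF K1(1) t] unfolding P3_Beckmann_eq[OF model F(2) t_def] by linarith
  qed
qed

theorem Stable_Dynamics_gap:
  assumes model: "congestion I = Stable_Dynamics"
    and opt: "is_arg_max (D3 I) (\<lambda>t. t \<in> dom_h I) tstar"
    and R: "R = norm (tstar - tbar I)" "0 < R"
    and K: "K = nat \<lceil>4 * (M_const I * R / \<epsilon>)\<^sup>2\<rceil>"
  defines "x \<equiv> pos_part (total_flow (fK K) - fbar I)"
    and "g \<equiv> P3 I (fK K) (dK K) - D3 I (t_pt (st K))"
  shows "0 \<le> g + x \<bullet> (tstar - tbar I)" and "g + x \<bullet> (tstar - tbar I) \<le> \<epsilon>" and "norm x \<le> 2 * \<epsilon> / R"
proof -
  note K1 = iteration_count[OF R(2) K]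
  note F = fK_bounds[OF K1(1)]
  let ?A = "weight (st K)" and ?u = "total_flow (fK K) - fbar I"
  have A: "0 < ?A" by (rule weight_pos[OF K1(1)])
  have tstar: "tstar \<in> dom_h I" "\<And>t. t \<in> dom_h I \<Longrightarrow> D3 I t \<le> D3 I tstar"
    using opt unfolding is_arg_max_def by (auto simp: not_less)
  \<comment> \<open>Passing to the positive part can only increase the pairing, because
    \<open>tstar\<close> lies above \<open>tbar I\<close>.\<close>
  have "?u \<bullet> (tstar - tbar I) \<le> x \<bullet> (tstar - tbar I)"
    unfolding inner_vec_def x_def pos_part_def using tstar(1)
    by (intro sum_mono) (auto simp: dom_h_def intro!: mult_right_mono)
  \<comment> \<open>Weak duality is applied at \<open>tstar\<close>, where the price of the
    violation is the one in the claim; optimality transfers it to \<open>t_pt\<close>.\<close>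
  moreover have "D3 I (t_pt (st K)) \<le> P3 I (fK K) (dK K) + ?u \<bullet> (tstar - tbar I)"
    using tstar(2)[OF t_pt_st, of K] E_min_le_lagrangian[OF dK_mode_tables fK_serves, OF K1(1) K1(1), of tstar]
    unfolding P3_Stable_Dynamics_eq[OF model] by (simp add: D3_eq)
  ultimately show lower: "0 \<le> g + x \<bullet> (tstar - tbar I)" by (simp add: g_def)
  have ux: "?u \<bullet> x = (norm x)\<^sup>2"
    unfolding power2_norm_eq_inner inner_vec_def x_def pos_part_def by (intro sum.cong) (auto simp: max_def)
  \<comment> \<open>Among the times \<open>tbar I + s\<close> with \<open>s \<ge> 0\<close>, this
    choice maximizes \<open>A * (?u \<bullet> s) - norm s ^ 2 / 2\<close> and so gives the strongest
    certificate.\<close>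
  have t: "tbar I + ?A *\<^sub>R x \<in> dom_h I"
    using A by (simp add: dom_h_def x_def pos_part_def)
  have gap: "?A * g + ?A\<^sup>2 * (norm x)\<^sup>2 / 2 \<le> \<epsilon> * (?A - 5 / 8 * (real K * c))"
  proof -
    have "?A * (P3 I (fK K) (dK K) + ?A * (norm x)\<^sup>2 - D3 I (t_pt (st K)))
        \<le> (?A * norm x)\<^sup>2 / 2 + \<epsilon> * (?A - 5 / 8 * (real K * c))"
      using duality_gap[OF K1(1) t] A unfolding P3_Stable_Dynamics_eq[OF model, symmetric]
      by (simp add: ux)
    then show ?thesis by (simp add: g_def power2_eq_square algebra_simps)
  qed
  have xR: "x \<bullet> (tstar - tbar I) \<le> R * norm x"
    unfolding R(1) by (metis mult.commute norm_cauchy_schwarz)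
  show "g + x \<bullet> (tstar - tbar I) \<le> \<epsilon>"
  proof (rule weighted_gap_le[OF K1])
    \<comment> \<open>Young's inequality: the quadratic excess term of \<open>gap\<close> absorbs
      the price of the violation at the cost of \<open>R^2 / 2\<close>.\<close>
    have "0 \<le> (?A * norm x - R)\<^sup>2" by simp
    then have "?A * (R * norm x) \<le> ?A\<^sup>2 * (norm x)\<^sup>2 / 2 + R\<^sup>2 / 2"
      by (simp add: power2_eq_square algebra_simps)
    moreover have "?A * (x \<bullet> (tstar - tbar I)) \<le> ?A * (R * norm x)" using xR A by simp
    ultimately show "?A * (g + x \<bullet> (tstar - tbar I)) \<le> R\<^sup>2 / 2 + \<epsilon> * (?A - 5 / 8 * (real K * c))"
      using gap unfolding distrib_left by linarith
  qed
  show "norm x \<le> 2 * \<epsilon> / R"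
  proof (cases "18 \<le> K")
    case True
    show ?thesis
    proof (rule excess_estimate[OF eps R(2) _ K1(2) _ gap])
      show "0 < real K * c" using K1(1) c_pos by simp
      show "5 / 4 * (real K * c) \<le> ?A" using weight_ge_late[OF True] by (simp add: mult.assoc)
      show "- (R * norm x) \<le> g" using lower xR by linarith
    qed
  next
    case False
    \<comment> \<open>With few iterations the crude bound suffices: the excess is at most the flow,
      hence at most \<open>M / sqrt 2\<close> in norm, while \<open>R\<close> is small because
      \<open>K\<close> is.\<close>
    have "norm x \<le> norm (total_flow (fK K))"
    proof (rule norm_le_componentwise_cart)
      fix e show "norm (x $ e) \<le> norm (total_flow (fK K) $ e)"
        unfolding x_def pos_part_def using F(2)[of e] fbar_pos[of e] by (simp add: max_def)
    qed
    then have "norm x \<le> sqrt (real (max_links I)) * total_demand I" using F(1) by linarith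
    then have "(norm x)\<^sup>2 \<le> (sqrt (real (max_links I)) * total_demand I)\<^sup>2" by (intro power_mono) auto
    also have "\<dots> = (M_const I)\<^sup>2 / 2" by (simp add: M_const_def power_mult_distrib)
    finally have x: "(norm x)\<^sup>2 \<le> (M_const I)\<^sup>2 / 2" .
    \<comment> \<open>Here \<open>K \<le> 17\<close>; the value 32 is what makes
      \<open>M^2 / 2 * (32 \<epsilon> c)\<close> equal to \<open>(2 \<epsilon>)^2\<close>.\<close>
    have "\<epsilon> * (real K * c) \<le> \<epsilon> * (32 * c)"
      using False eps c_pos by (intro mult_left_mono mult_right_mono) auto
    then have "R\<^sup>2 \<le> \<epsilon> * (32 * c)" using K1(2) by linarith
    then have "(norm x)\<^sup>2 * R\<^sup>2 \<le> (M_const I)\<^sup>2 / 2 * (\<epsilon> * (32 * c))"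
      using x by (intro mult_mono) auto
    also have "\<dots> = (2 * \<epsilon>)\<^sup>2" using M_pos by (simp add: c_def power2_eq_square)
    finally have "(norm x * R)\<^sup>2 \<le> (2 * \<epsilon>)\<^sup>2" by (simp add: power_mult_distrib)
    then have "norm x * R \<le> 2 * \<epsilon>" by (rule power2_le_imp_le) (use eps in simp)
    then show ?thesis using R(2) by (simp add: field_simps)
  qed
qed

end

theorem theorem3p4:
  fixes I :: "('v, 'e::finite, 'r::finite, 'a::finite, 'm::finite) traffic_problem"
    and orc :: "('v, 'e, 'r, 'a) oracle_fun"
    and f :: "nat \<Rightarrow> 'm \<Rightarrow> real ^ 'e"
    and t0 tstar :: "real ^ 'e"
    and L0 \<epsilon> R :: real
  assumes problem: "well_posed I"
    and eps: "0 < \<epsilon>"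
    and t0: "t0 = tbar I"
    and L0: "0 < L0" "L0 \<le> (M_const I)\<^sup>2 / \<epsilon>"
    and accurate: "oracle_accurate I orc t0 L0 \<epsilon>"
    and flows: "\<And>k. 1 \<le> k \<Longrightarrow>
        f k \<in> shortest_path_flows I (y_pt (run I orc t0 L0 \<epsilon> k)) (trips_at I orc t0 L0 \<epsilon> k) \<and>
        total_flow (f k) = snd (reply_at I orc t0 L0 \<epsilon> k)"
    and tstar: "is_arg_max (D3 I) (\<lambda>t. t \<in> dom_h I) tstar"
    and R: "R = norm (tstar - tbar I)"
  shows
    "(congestion I = Beckmann \<longrightarrow>
       (let K = nat \<lceil>4 * (M_const I * R_tilde I / \<epsilon>)\<^sup>2\<rceil>;
            fK = f_hat I orc t0 L0 \<epsilon> f K;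
            dK = d_hat I orc t0 L0 \<epsilon> K;
            tK = t_pt (run I orc t0 L0 \<epsilon> K)
        in 0 \<le> P3 I fK dK - D3 I tK \<and> P3 I fK dK - D3 I tK \<le> \<epsilon>)) \<and>
     (congestion I = Stable_Dynamics \<and> 0 < R \<longrightarrow>
       (let K = nat \<lceil>4 * (M_const I * R / \<epsilon>)\<^sup>2\<rceil>;
            fK = f_hat I orc t0 L0 \<epsilon> f K;
            dK = d_hat I orc t0 L0 \<epsilon> K;
            tK = t_pt (run I orc t0 L0 \<epsilon> K);
            excess = pos_part (total_flow fK - fbar I);
            gap = P3 I fK dK - D3 I tK + excess \<bullet> (tstar - tbar I)
        in 0 \<le> gap \<and> gap \<le> \<epsilon> \<and> norm excess \<le> 2 * \<epsilon> / R))"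
proof -
  interpret traffic_run I orc f L0 \<epsilon>
    by (intro traffic_run.intro traffic.intro traffic_run_axioms.intro)
      (fact problem eps L0 accurate[unfolded t0] flows[unfolded t0])+
  show ?thesis
    unfolding Let_def t0 run_st
    using Beckmann_gap[OF _ refl] Stable_Dynamics_gap[OF _ tstar R _ refl] by simp
qed

end
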